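(* Let $u_0\in C(\overline{\Omega})$, let $w_{r,h}$ be the solution of the discrete problem (D$_{r,h}$) of the context, and let $$\overline{w}(\alpha,t)=\limsup_{\substack{h\to0^+,\ r\to0\\ x\in\tilde{\Omega}_{r,h},\ x\to\alpha,\ s\to t}}w_{r,h}(x,s),\qquad\underline{w}(\alpha,t)=\liminf_{\substack{h\to0^+,\ r\to0\\ x\in\tilde{\Omega}_{r,h},\ x\to\alpha,\ s\to t}}w_{r,h}(x,s)$$ for $(\alpha,t)\in[a,b]\times[0,\infty)$. Let $w$ be the (viscosity) solution of the Neumann problem (HJE) of the context. Then $\overline{w}=\underline{w}=w$ on $[a,b]\times[0,\infty)$.
   Context: Setting. $\mathbb{R}^2_+=\{x\in\mathbb{R}^2:x_1>0,x_2>0\}$; $\Omega\subset\mathbb{R}^2_+$ is a bounded open domain with Lipschitz boundary and $\overline{\Omega}\subset\mathbb{R}^2_+$. The reaction vector is $\vec{\nu}=(-\nu^+_{11},\nu^-_{12})$ with nonnegative integers $\nu^+_{11},\nu^-_{12}$ not both zero. The intensities $\Phi^\pm:\overline{\Omega}\to\mathbb{R}$ are continuous with $\Phi^\pm\ge c_0>0$. Fix $\vec{x}_0\in\overline{\Omega}$; $[a,b]\ni0$ is the largest interval with $\{\vec{x}_0+\alpha\vec{\nu}:a\le\alpha\le b\}\subset\overline{\Omega}$, and $a<b$. Put $\tilde{\Phi}^\pm(\alpha)=\Phi^\pm(\vec{x}_0+\alpha\vec{\nu})$ and $w_0(\alpha)=u_0(\vec{x}_0+\alpha\vec{\nu})$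 for $\alpha\in[a,b]$. Discrete problem (D$_{r,h}$). For $h>0$ and $r\in\mathbb{R}$ small, $\tilde{\Omega}_{r,h}=\{r+kh:k\in\mathbb{Z},\ a\le r+kh\le b\}$, and $w_{r,h}:\tilde{\Omega}_{r,h}\times[0,\infty)\to\mathbb{R}$ is the unique solution of $$\partial_tw_{r,h}(x,t)=\mathbb{1}_{\{x+h\in\tilde{\Omega}_{r,h}\}}\tilde{\Phi}^+(x)\Big(e^{\frac{w_{r,h}(x+h,t)-w_{r,h}(x,t)}{h}}-1\Big)+\mathbb{1}_{\{x-h\in\tilde{\Omega}_{r,h}\}}\tilde{\Phi}^-(x)\Big(e^{\frac{w_{r,h}(x-h,t)-w_{r,h}(x,t)}{h}}-1\Big)$$ for $x\in\tilde{\Omega}_{r,h}$, $t>0$, with $w_{r,h}(x,0)=w_0(x)$. Continuous problem (HJE). With $\tilde{H}(\alpha,p)=\tilde{\Phi}^+(\alpha)(e^p-1)+\tilde{\Phi}^-(\alpha)(e^{-p}-1)$, $$\partial_tw=\tilde{H}(\alpha,\partial_\alpha w)\ \text{in }(a,b)\times(0,\infty),\quad-\partial_\alpha w(a,t)=\partial_\alpha w(b,t)=0\ (t>0),\quad w(\cdot,0)=w_0\ \text{on }[a,b],$$ in the viscosity sense. An upper semicontinuous $v$ on $[a,b]\times[0,\infty)$ is a subsolution if $v(\cdot,0)\le w_0$ and, whenever $\varphi\in C^1$ and $v-\varphi$ has a local maximum at $(\alpha_0,t_0)$, $t_0>0$: $\partial_t\varphi-\tilde{H}(\alpha_0,\partial_\alpha\varphi)\le0$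 at $(\alpha_0,t_0)$ if $\alpha_0\in(a,b)$; $\min\{\partial_t\varphi-\tilde{H}(a,\partial_\alpha\varphi),-\partial_\alpha\varphi\}\le0$ if $\alpha_0=a$; $\min\{\partial_t\varphi-\tilde{H}(b,\partial_\alpha\varphi),\partial_\alpha\varphi\}\le0$ if $\alpha_0=b$. A lower semicontinuous $v$ is a supersolution if $v(\cdot,0)\ge w_0$ and the corresponding conditions hold at local minima with $\le$ replaced by $\ge$ and $\min$ by $\max$. A solution is a continuous function that is both a subsolution and a supersolution; it is unique. *)

theory Defs
  imports "HOL-Analysis.Analysis"
begin

definition positive_quadrant :: "(real^2) set" where
  "positive_quadrant = {x. x $ 1 > 0 \<and> x $ 2 > 0}"

text \<open>
  Near each boundary point, in suitable orthonormal coordinates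
  (\<open>y \<bullet> e\<close>, \<open>y \<bullet> n\<close>), the set is the strict epigraph of a Lipschitz function.
\<close>
definition lipschitz_boundary :: "(real^2) set \<Rightarrow> bool" where
  "lipschitz_boundary S \<longleftrightarrow>
     (\<forall>z \<in> frontier S. \<exists>\<rho> > 0. \<exists>e n. \<exists>L. \<exists>\<gamma> :: real \<Rightarrow> real.
        norm e = 1 \<and> norm n = 1 \<and> e \<bullet> n = 0 \<and> L-lipschitz_on UNIV \<gamma> \<and>
        S \<inter> ball z \<rho> = {y \<in> ball z \<rho>. \<gamma> (y \<bullet> e) < y \<bullet> n})"

definition reaction_vector :: "nat \<Rightarrow> nat \<Rightarrow> real^2" where
  "reaction_vector \<nu>p \<nu>m = vector [- real \<nu>p, real \<nu>m]"

definition along :: "real^2 \<Rightarrow> real^2 \<Rightarrow> (real^2 \<Rightarrow> real) \<Rightarrow> real \<Rightarrow> real" where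
  "along x0 \<nu> f \<alpha> = f (x0 + \<alpha> *\<^sub>R \<nu>)"

definition largest_interval :: "(real^2) set \<Rightarrow> real^2 \<Rightarrow> real^2 \<Rightarrow> real \<Rightarrow> real \<Rightarrow> bool" where
  "largest_interval S x0 \<nu> a b \<longleftrightarrow>
     0 \<in> {a..b} \<and> (\<forall>\<alpha>\<in>{a..b}. x0 + \<alpha> *\<^sub>R \<nu> \<in> S) \<and>
     (\<forall>a' b'. 0 \<in> {a'..b'} \<longrightarrow> (\<forall>\<alpha>\<in>{a'..b'}. x0 + \<alpha> *\<^sub>R \<nu> \<in> S) \<longrightarrow> {a'..b'} \<subseteq> {a..b})"

definition grid :: "real \<Rightarrow> real \<Rightarrow> real \<Rightarrow> real \<Rightarrow> real set" where
  "grid a b r h = {x. (\<exists>k::int. x = r + of_int k * h) \<and> a \<le> x \<and> x \<le> b}"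

text \<open>
  The initial value is attained continuously; the equation is required for \<open>t > 0\<close> only.
\<close>
definition discrete_solution ::
  "(real \<Rightarrow> real) \<Rightarrow> (real \<Rightarrow> real) \<Rightarrow> (real \<Rightarrow> real) \<Rightarrow> real \<Rightarrow> real \<Rightarrow> real \<Rightarrow> real
    \<Rightarrow> (real \<Rightarrow> real \<Rightarrow> real) \<Rightarrow> bool" where
  "discrete_solution \<Phi>p \<Phi>m w0 a b r h W \<longleftrightarrow>
     (\<forall>x \<in> grid a b r h.
        W x 0 = w0 x \<and> continuous_on {0..} (W x) \<and>
        (\<forall>t>0. (W x has_real_derivative
            (of_bool (x + h \<in> grid a b r h) * \<Phi>p x * (exp ((W (x + h) t - W x t) / h) - 1)
           + of_bool (x - h \<in> grid a b r h) * \<Phi>m x * (exp ((W (x - h) t - W x t) / h) - 1)))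
          (at t)))"

text \<open>
  Convergence of \<open>(h, r, x, s)\<close> to \<open>(0+, 0, \<alpha>, t)\<close> with \<open>x\<close> in the grid for \<open>(r, h)\<close> and \<open>s \<ge> 0\<close>.
  The values \<open>r = 0\<close>, \<open>x = \<alpha>\<close> and \<open>s = t\<close> are admitted.
\<close>
definition relaxed_filter :: "real \<Rightarrow> real \<Rightarrow> real \<Rightarrow> real \<Rightarrow> (real \<times> real \<times> real \<times> real) filter" where
  "relaxed_filter a b \<alpha> t =
     inf (at_right 0 \<times>\<^sub>F nhds 0 \<times>\<^sub>F nhds \<alpha> \<times>\<^sub>F nhds t)
         (principal {(h, r, x, s). x \<in> grid a b r h \<and> 0 \<le> s})"

definition relaxed_limsup ::
  "real \<Rightarrow> real \<Rightarrow> (real \<Rightarrow> real \<Rightarrow> real \<Rightarrow> real \<Rightarrow> real) \<Rightarrow> real \<Rightarrow> real \<Rightarrow> ereal" where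
  "relaxed_limsup a b W \<alpha> t =
     Limsup (relaxed_filter a b \<alpha> t) (\<lambda>(h, r, x, s). ereal (W r h x s))"

definition relaxed_liminf ::
  "real \<Rightarrow> real \<Rightarrow> (real \<Rightarrow> real \<Rightarrow> real \<Rightarrow> real \<Rightarrow> real) \<Rightarrow> real \<Rightarrow> real \<Rightarrow> ereal" where
  "relaxed_liminf a b W \<alpha> t =
     Liminf (relaxed_filter a b \<alpha> t) (\<lambda>(h, r, x, s). ereal (W r h x s))"

definition hamiltonian :: "(real \<Rightarrow> real) \<Rightarrow> (real \<Rightarrow> real) \<Rightarrow> real \<Rightarrow> real \<Rightarrow> real" where
  "hamiltonian \<Phi>p \<Phi>m \<alpha> p = \<Phi>p \<alpha> * (exp p - 1) + \<Phi>m \<alpha> * (exp (- p) - 1)"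

definition usc_on :: "'a::topological_space set \<Rightarrow> ('a \<Rightarrow> real) \<Rightarrow> bool" where
  "usc_on S v \<longleftrightarrow> (\<forall>p\<in>S. \<forall>c > v p. \<forall>\<^sub>F q in at p within S. v q < c)"

definition lsc_on :: "'a::topological_space set \<Rightarrow> ('a \<Rightarrow> real) \<Rightarrow> bool" where
  "lsc_on S v \<longleftrightarrow> (\<forall>p\<in>S. \<forall>c < v p. \<forall>\<^sub>F q in at p within S. c < v q)"

definition local_max_on :: "'a::topological_space set \<Rightarrow> ('a \<Rightarrow> real) \<Rightarrow> 'a \<Rightarrow> bool" where
  "local_max_on S f p \<longleftrightarrow> p \<in> S \<and> (\<forall>\<^sub>F q in at p within S. f q \<le> f p)"

definition local_min_on :: "'a::topological_space set \<Rightarrow> ('a \<Rightarrow> real) \<Rightarrow> 'a \<Rightarrow> bool" where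
  "local_min_on S f p \<longleftrightarrow> p \<in> S \<and> (\<forall>\<^sub>F q in at p within S. f p \<le> f q)"

text \<open>
  \<open>\<phi>\<close> is continuously differentiable on the plane, with partial derivatives \<open>\<phi>\<^sub>\<alpha>\<close>, \<open>\<phi>\<^sub>t\<close>.
\<close>
definition C1_with_partials ::
  "(real \<times> real \<Rightarrow> real) \<Rightarrow> (real \<times> real \<Rightarrow> real) \<Rightarrow> (real \<times> real \<Rightarrow> real) \<Rightarrow> bool" where
  "C1_with_partials \<phi> \<phi>\<^sub>\<alpha> \<phi>\<^sub>t \<longleftrightarrow>
     continuous_on UNIV \<phi>\<^sub>\<alpha> \<and> continuous_on UNIV \<phi>\<^sub>t \<and>
     (\<forall>p. (\<phi> has_derivative (\<lambda>(d\<alpha>, dt). \<phi>\<^sub>\<alpha> p * d\<alpha> + \<phi>\<^sub>t p * dt)) (at p))"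

definition viscosity_subsolution ::
  "(real \<Rightarrow> real \<Rightarrow> real) \<Rightarrow> (real \<Rightarrow> real) \<Rightarrow> real \<Rightarrow> real \<Rightarrow> (real \<times> real \<Rightarrow> real) \<Rightarrow> bool" where
  "viscosity_subsolution H w0 a b v \<longleftrightarrow>
     usc_on ({a..b} \<times> {0..}) v \<and> (\<forall>\<alpha>\<in>{a..b}. v (\<alpha>, 0) \<le> w0 \<alpha>) \<and>
     (\<forall>\<phi> \<phi>\<^sub>\<alpha> \<phi>\<^sub>t \<alpha>0 t0.
        C1_with_partials \<phi> \<phi>\<^sub>\<alpha> \<phi>\<^sub>t \<longrightarrow> 0 < t0 \<longrightarrow>
        local_max_on ({a..b} \<times> {0..}) (\<lambda>p. v p - \<phi> p) (\<alpha>0, t0) \<longrightarrow>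
          (\<alpha>0 \<in> {a<..<b} \<longrightarrow> \<phi>\<^sub>t (\<alpha>0, t0) - H \<alpha>0 (\<phi>\<^sub>\<alpha> (\<alpha>0, t0)) \<le> 0) \<and>
          (\<alpha>0 = a \<longrightarrow> min (\<phi>\<^sub>t (a, t0) - H a (\<phi>\<^sub>\<alpha> (a, t0))) (- \<phi>\<^sub>\<alpha> (a, t0)) \<le> 0) \<and>
          (\<alpha>0 = b \<longrightarrow> min (\<phi>\<^sub>t (b, t0) - H b (\<phi>\<^sub>\<alpha> (b, t0))) (\<phi>\<^sub>\<alpha> (b, t0)) \<le> 0))"

definition viscosity_supersolution ::
  "(real \<Rightarrow> real \<Rightarrow> real) \<Rightarrow> (real \<Rightarrow> real) \<Rightarrow> real \<Rightarrow> real \<Rightarrow> (real \<times> real \<Rightarrow> real) \<Rightarrow> bool" where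
  "viscosity_supersolution H w0 a b v \<longleftrightarrow>
     lsc_on ({a..b} \<times> {0..}) v \<and> (\<forall>\<alpha>\<in>{a..b}. v (\<alpha>, 0) \<ge> w0 \<alpha>) \<and>
     (\<forall>\<phi> \<phi>\<^sub>\<alpha> \<phi>\<^sub>t \<alpha>0 t0.
        C1_with_partials \<phi> \<phi>\<^sub>\<alpha> \<phi>\<^sub>t \<longrightarrow> 0 < t0 \<longrightarrow>
        local_min_on ({a..b} \<times> {0..}) (\<lambda>p. v p - \<phi> p) (\<alpha>0, t0) \<longrightarrow>
          (\<alpha>0 \<in> {a<..<b} \<longrightarrow> \<phi>\<^sub>t (\<alpha>0, t0) - H \<alpha>0 (\<phi>\<^sub>\<alpha> (\<alpha>0, t0)) \<ge> 0) \<and>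
          (\<alpha>0 = a \<longrightarrow> max (\<phi>\<^sub>t (a, t0) - H a (\<phi>\<^sub>\<alpha> (a, t0))) (- \<phi>\<^sub>\<alpha> (a, t0)) \<ge> 0) \<and>
          (\<alpha>0 = b \<longrightarrow> max (\<phi>\<^sub>t (b, t0) - H b (\<phi>\<^sub>\<alpha> (b, t0))) (\<phi>\<^sub>\<alpha> (b, t0)) \<ge> 0))"

definition viscosity_solution ::
  "(real \<Rightarrow> real \<Rightarrow> real) \<Rightarrow> (real \<Rightarrow> real) \<Rightarrow> real \<Rightarrow> real \<Rightarrow> (real \<times> real \<Rightarrow> real) \<Rightarrow> bool" where
  "viscosity_solution H w0 a b v \<longleftrightarrow>
     continuous_on ({a..b} \<times> {0..}) v \<and>
     viscosity_subsolution H w0 a b v \<and> viscosity_supersolution H w0 a b v"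

end

theory Submission
  imports Defs
begin

text \<open>
  The theorem is a consequence of uniform convergence: for every horizon, the discrete solutions
  \<open>W\<close> are uniformly close to the viscosity solution \<open>w\<close> on the grid, up to that horizon, once the
  mesh \<open>h\<close> is small (\<open>discrete_uniformly_close\<close>). Since \<open>w\<close> is continuous, \<open>W\<close> then converges to
  \<open>w (\<alpha>, t)\<close> along the filter that defines the relaxed limits, and that filter is proper.

  Closeness is obtained by doubling the variables between \<open>W\<close> and \<open>w\<close> themselves. Let \<open>u\<close>
  be one of the two functions and \<open>v\<close> the other, let \<open>m\<close> be the midpoint of \<open>[a, b]\<close>, and consider
  a maximum point of
    \<open>u (x, t) - v (y, s) - (x - y)\<^sup>2 / 2\<epsilon> - (t - s)\<^sup>2 / 2\<delta> - \<kappa> (x - m)\<^sup>2 - \<kappa> (y - m)\<^sup>2 - g t - g s\<close>.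
  The terms with \<open>\<kappa>\<close> make the test functions strictly monotone, in the direction pointing out of
  the interval, at its ends; this
  excludes the Neumann alternative of the boundary conditions for \<open>w\<close>, and it compensates for the
  missing neighbour of \<open>W\<close> at an extreme grid point. The function \<open>g\<close> grows at rate at least \<open>\<eta> > 0\<close>,
  is negligible up to the horizon of interest and so large one time unit later that the maximum stays away
  from the end of the time interval. Maxima with \<open>t = 0\<close> or \<open>s = 0\<close> are excluded because
  \<open>W\<close> and \<open>w\<close> leave the initial value at a rate that is uniform in \<open>h\<close>
  (\<open>discrete_initial_layer\<close>).

  At the remaining maximum points the equations for \<open>u\<close> and \<open>v\<close> give
    \<open>H (y, q) \<le> \<tau> - \<eta>\<close> and \<open>\<tau> + \<eta> \<le> H (x, p)\<close>, where \<open>\<tau> = (t - s) / \<delta>\<close>,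
  up to an error of order \<open>h\<close>, bounded by \<open>\<theta>\<close>, in the momenta on the discrete side, while \<open>p - q = O(\<kappa>)\<close>. The
  intensities are merely continuous, so \<open>H (x, p) - H (y, q)\<close> is small only if \<open>q\<close> is bounded
  independently of \<open>\<epsilon>\<close>. This is where coercivity enters: \<open>\<bar>\<tau>\<bar>\<close> is bounded in terms of \<open>\<delta>\<close> alone, and as
  \<open>\<Phi>p, \<Phi>m \<ge> c0\<close>, the inequality \<open>H (y, q) \<le> \<tau>\<close> bounds both \<open>exp q\<close> and \<open>exp (- q)\<close>. Hence
  \<open>\<delta>\<close> is fixed first, then \<open>\<kappa>\<close> and \<open>\<theta>\<close>, then \<open>\<epsilon>\<close>, and \<open>h\<close> last, which contradicts \<open>\<eta> > 0\<close>.
\<close>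

section \<open>The Hamiltonian with two independent momenta\<close>

text \<open>
  The Hamiltonian at \<open>p\<close> is the case \<open>q = - p\<close>. On the grid, the forward and the backward
  difference quotient are not opposite to each other, and consistency errors push both of them in
  the same direction.
\<close>

definition flux :: "(real \<Rightarrow> real) \<Rightarrow> (real \<Rightarrow> real) \<Rightarrow> real \<Rightarrow> real \<Rightarrow> real \<Rightarrow> real" where
  "flux \<Phi>p \<Phi>m x p q = \<Phi>p x * (exp p - 1) + \<Phi>m x * (exp q - 1)"

text \<open>
  The exponential has no global modulus of continuity, so the increment in the momentum is measured
  multiplicatively: \<open>exp X - exp Y \<le> exp Y * (exp \<mu> - 1)\<close>, and only \<open>exp Y\<close> has to be bounded.
\<close>

lemma one_flux_gap:
  fixes A A' X Y :: real
  assumes "0 \<le> A" "A \<le> B" "\<bar>A - A'\<bar> \<le> \<omega>" "X \<le> Y + \<mu>" "0 \<le> \<mu>" "exp Y \<le> E"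
  shows "A * (exp X - 1) - A' * (exp Y - 1) \<le> B * E * (exp \<mu> - 1) + \<omega> * (E + 1)"
proof -
  have "exp X \<le> exp Y * exp \<mu>"
    using assms by (simp flip: exp_add)
  then have "exp X - exp Y \<le> exp Y * (exp \<mu> - 1)"
    by (simp add: algebra_simps)
  also have "\<dots> \<le> E * (exp \<mu> - 1)"
    using assms by (intro mult_right_mono) auto
  finally have "A * (exp X - exp Y) \<le> A * (E * (exp \<mu> - 1))"
    using assms by (intro mult_left_mono) auto
  also have "\<dots> \<le> B * (E * (exp \<mu> - 1))"
    using assms order_trans[OF exp_ge_zero assms(6)] by (intro mult_right_mono mult_nonneg_nonneg) auto
  finally have 1: "A * (exp X - exp Y) \<le> B * E * (exp \<mu> - 1)" by simp
  have "(A - A') * (exp Y - 1) \<le> \<bar>A - A'\<bar> * \<bar>exp Y - 1\<bar>"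
    by (metis abs_ge_self abs_mult)
  also have "\<dots> \<le> \<omega> * (E + 1)"
  proof (rule mult_mono)
    show "\<bar>exp Y - 1\<bar> \<le> E + 1"
      using assms(6) exp_gt_zero[of Y] by linarith
  qed (use assms in auto)
  finally show ?thesis using 1 by (simp add: algebra_simps)
qed

section \<open>Grids and discrete solutions\<close>

lemma deriv_nonneg_at_right_max:
  fixes f :: "real \<Rightarrow> real"
  assumes "(f has_real_derivative D) (at t)" "0 < t" "\<And>s. 0 \<le> s \<Longrightarrow> s \<le> t \<Longrightarrow> f s \<le> f t"
  shows "0 \<le> D"
proof (rule ccontr)
  assume "\<not> 0 \<le> D"
  then obtain d where d: "d > 0" "\<And>h. 0 < h \<Longrightarrow> h < d \<Longrightarrow> f t < f (t - h)"
    using DERIV_neg_dec_left[OF assms(1)] by auto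
  have "f t < f (t - min (d/2) t)" using d assms(2) by (intro d(2)) auto
  moreover have "f (t - min (d/2) t) \<le> f t" using d assms by (intro assms(3)) auto
  ultimately show False by simp
qed

lemma finite_grid: "0 < h \<Longrightarrow> finite (grid a b r h)"
proof -
  assume h: "0 < h"
  have "grid a b r h \<subseteq> (\<lambda>k::int. r + of_int k * h) ` {\<lfloor>(a - r) / h\<rfloor>..\<lceil>(b - r) / h\<rceil>}"
  proof
    fix x assume "x \<in> grid a b r h"
    then obtain k :: int where k: "x = r + of_int k * h" "a \<le> x" "x \<le> b"
      by (auto simp: grid_def)
    have "(a - r) / h \<le> k" "k \<le> (b - r) / h" using k h by (auto simp: field_simps)
    then have "k \<in> {\<lfloor>(a - r) / h\<rfloor>..\<lceil>(b - r) / h\<rceil>}" by (auto; linarith)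
    then show "x \<in> (\<lambda>k::int. r + of_int k * h) ` {\<lfloor>(a - r) / h\<rfloor>..\<lceil>(b - r) / h\<rceil>}"
      using k by blast
  qed
  then show ?thesis by (rule finite_subset) auto
qed

lemma grid_subset: "grid a b r h \<subseteq> {a..b}"
  by (auto simp: grid_def)

lemma grid_step:
  assumes "x \<in> grid a b r h" "0 < h"
  shows "x + h \<in> grid a b r h \<longleftrightarrow> x + h \<le> b" "x - h \<in> grid a b r h \<longleftrightarrow> a \<le> x - h"
proof -
  obtain k :: int where k: "x = r + of_int k * h" "a \<le> x" "x \<le> b"
    using assms by (auto simp: grid_def)
  have "x + h = r + of_int (k + 1) * h" "x - h = r + of_int (k - 1) * h"
    using k by (auto simp: algebra_simps)
  then show "x + h \<in> grid a b r h \<longleftrightarrow> x + h \<le> b" "x - h \<in> grid a b r h \<longleftrightarrow> a \<le> x - h"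
    unfolding grid_def using k assms(2) by (auto intro: exI[of _ "k+1"] exI[of _ "k-1"])
qed

text \<open>
  The grid is finite, hence its slices \<open>{x} \<times> {0..T}\<close> are finitely many closed sets on which
  continuity can be checked separately.
\<close>

lemma discrete_solution_continuous:
  assumes "discrete_solution \<Phi>p \<Phi>m w0 a b r h W" "0 < h"
  shows "continuous_on (grid a b r h \<times> {0..T}) (\<lambda>(x, t). W x t)"
proof -
  have "continuous_on (\<Union>x\<in>grid a b r h. {x} \<times> {0..T}) (\<lambda>(x, t). W x t)"
  proof (rule continuous_on_closed_Union)
    show "finite (grid a b r h)" using finite_grid assms by blast
    show "closed ({x} \<times> {0..T})" for x :: real by (intro closed_Times) auto
    fix x assume "x \<in> grid a b r h"
    then have "continuous_on {0..T} (W x)"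
      using assms by (auto simp: discrete_solution_def intro: continuous_on_subset)
    then have "continuous_on ({x} \<times> {0..T}) (\<lambda>p. W x (snd p))"
      by (rule continuous_on_compose2) (auto intro: continuous_intros)
    then show "continuous_on ({x} \<times> {0..T}) (\<lambda>(x, t). W x t)"
      by (rule continuous_on_eq) auto
  qed
  moreover have "(\<Union>x\<in>grid a b r h. {x} \<times> {0..T}) = grid a b r h \<times> {0..T}" by auto
  ultimately show ?thesis by simp
qed

locale intensities =
  fixes \<Phi>p \<Phi>m :: "real \<Rightarrow> real" and a b c0 B :: real
  assumes ab: "a < b" and c0: "0 < c0"
    and p_bounds: "\<And>x. x \<in> {a..b} \<Longrightarrow> c0 \<le> \<Phi>p x \<and> \<Phi>p x \<le> B"
    and m_bounds: "\<And>x. x \<in> {a..b} \<Longrightarrow> c0 \<le> \<Phi>m x \<and> \<Phi>m x \<le> B"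
begin

lemma B_pos: "0 < B"
  using p_bounds[of a] ab c0 by auto

lemma flux_mono:
  assumes "x \<in> {a..b}" "p \<le> p'" "q \<le> q'"
  shows "flux \<Phi>p \<Phi>m x p q \<le> flux \<Phi>p \<Phi>m x p' q'"
  unfolding flux_def using p_bounds[of x] m_bounds[of x] assms c0
  by (intro add_mono mult_left_mono) auto

text \<open>
  Coercivity: each exponential has a coefficient that is at least \<open>c0\<close>, and the remaining terms are
  bounded below by \<open>- 2 * B\<close>.
\<close>

lemma exp_le_of_flux_le:
  assumes "y \<in> {a..b}" "flux \<Phi>p \<Phi>m y p q \<le> \<tau>"
  shows "exp p \<le> (\<tau> + 2 * B) / c0" "exp q \<le> (\<tau> + 2 * B) / c0"
proof -
  have "c0 * exp p \<le> \<Phi>p y * exp p" "c0 * exp q \<le> \<Phi>m y * exp q"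
    using p_bounds[of y] m_bounds[of y] assms by auto
  moreover have "0 \<le> c0 * exp p" "0 \<le> c0 * exp q" using c0 by auto
  moreover have "\<Phi>p y * exp p + \<Phi>m y * exp q \<le> \<tau> + 2 * B"
    using assms p_bounds[of y] m_bounds[of y] by (auto simp: flux_def algebra_simps)
  ultimately have "c0 * exp p \<le> \<tau> + 2 * B" "c0 * exp q \<le> \<tau> + 2 * B" by linarith+
  then show "exp p \<le> (\<tau> + 2 * B) / c0" "exp q \<le> (\<tau> + 2 * B) / c0"
    using c0 by (auto simp: field_simps)
qed

definition drift :: "real \<Rightarrow> real \<Rightarrow> (real \<Rightarrow> real \<Rightarrow> real) \<Rightarrow> real \<Rightarrow> real \<Rightarrow> real" where
  "drift r h W x t =
     of_bool (x + h \<in> grid a b r h) * \<Phi>p x * (exp ((W (x + h) t - W x t) / h) - 1)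
   + of_bool (x - h \<in> grid a b r h) * \<Phi>m x * (exp ((W (x - h) t - W x t) / h) - 1)"

lemma discrete_solutionD:
  assumes "discrete_solution \<Phi>p \<Phi>m w0 a b r h W" "x \<in> grid a b r h"
  shows "W x 0 = w0 x" "continuous_on {0..} (W x)"
    "0 < t \<Longrightarrow> (W x has_real_derivative drift r h W x t) (at t)"
  using assms unfolding discrete_solution_def drift_def by auto

text \<open>
  Difference quotients that point out of the interval do not contribute to the drift. Bounding the
  drift by a full flux is therefore possible if the momentum has the right sign where a neighbour is
  missing; this is the discrete counterpart of the Neumann condition.
\<close>

lemma drift_le_flux:
  assumes "x \<in> {a..b}" "0 < h"
    and "x + h \<in> grid a b r h \<Longrightarrow> W (x + h) t - W x t \<le> h * p"
    and "x - h \<in> grid a b r h \<Longrightarrow> W (x - h) t - W x t \<le> h * q"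
    and "x + h \<notin> grid a b r h \<Longrightarrow> 0 \<le> p" and "x - h \<notin> grid a b r h \<Longrightarrow> 0 \<le> q"
  shows "drift r h W x t \<le> flux \<Phi>p \<Phi>m x p q"
proof -
  have "of_bool (x + h \<in> grid a b r h) * \<Phi>p x * (exp ((W (x + h) t - W x t) / h) - 1)
      \<le> \<Phi>p x * (exp p - 1)"
    using assms(1,2,3,5) p_bounds[of x] c0
    by (cases "x + h \<in> grid a b r h") (auto simp: field_simps)
  moreover have "of_bool (x - h \<in> grid a b r h) * \<Phi>m x * (exp ((W (x - h) t - W x t) / h) - 1)
      \<le> \<Phi>m x * (exp q - 1)"
    using assms(1,2,4,6) m_bounds[of x] c0
    by (cases "x - h \<in> grid a b r h") (auto simp: field_simps)
  ultimately show ?thesis by (simp add: drift_def flux_def)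
qed

lemma drift_ge_flux:
  assumes "x \<in> {a..b}" "0 < h"
    and "x + h \<in> grid a b r h \<Longrightarrow> h * p \<le> W (x + h) t - W x t"
    and "x - h \<in> grid a b r h \<Longrightarrow> h * q \<le> W (x - h) t - W x t"
    and "x + h \<notin> grid a b r h \<Longrightarrow> p \<le> 0" and "x - h \<notin> grid a b r h \<Longrightarrow> q \<le> 0"
  shows "flux \<Phi>p \<Phi>m x p q \<le> drift r h W x t"
proof -
  have "\<Phi>p x * (exp p - 1)
      \<le> of_bool (x + h \<in> grid a b r h) * \<Phi>p x * (exp ((W (x + h) t - W x t) / h) - 1)"
    using assms(1,2,3,5) p_bounds[of x] c0
    by (cases "x + h \<in> grid a b r h") (auto simp: field_simps mult_le_0_iff)
  moreover have "\<Phi>m x * (exp q - 1)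
      \<le> of_bool (x - h \<in> grid a b r h) * \<Phi>m x * (exp ((W (x - h) t - W x t) / h) - 1)"
    using assms(1,2,4,6) m_bounds[of x] c0
    by (cases "x - h \<in> grid a b r h") (auto simp: field_simps mult_le_0_iff)
  ultimately show ?thesis by (simp add: drift_def flux_def)
qed

text \<open>
  The exponentials are nonnegative, so the drift never falls below \<open>- 2 * B\<close>.
\<close>

lemma discrete_lower_bound:
  assumes W: "discrete_solution \<Phi>p \<Phi>m w0 a b r h W" and x: "x \<in> grid a b r h" and t: "0 \<le> t"
  shows "w0 x - 2 * B * t \<le> W x t"
proof -
  have xab: "x \<in> {a..b}" using x grid_subset by blast
  have "W x 0 + 2 * B * 0 \<le> W x t + 2 * B * t"
  proof (rule DERIV_nonneg_imp_increasing_open[where f = "\<lambda>t. W x t + 2 * B * t", OF t])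
    fix s :: real assume s: "0 < s" "s < t"
    have D: "((\<lambda>t. W x t + 2 * B * t) has_real_derivative drift r h W x s + 2 * B) (at s)"
      using discrete_solutionD(3)[OF W x s(1)] by (auto intro!: derivative_eq_intros)
    have pb: "of_bool P * f * (e - 1) \<ge> - B"
      if "0 \<le> f" "f \<le> B" "0 \<le> e" for P f and e :: real
    proof -
      have "0 \<le> f * e" using that by simp
      then have "- B \<le> f * e - f" using that by linarith
      then show ?thesis using B_pos by (cases P) (auto simp: right_diff_distrib)
    qed
    have "- B - B \<le> drift r h W x s"
      unfolding drift_def diff_conv_add_uminus[of "- B"] using p_bounds[OF xab] m_bounds[OF xab] c0
      by (intro add_mono pb) auto
    then show "\<exists>y. DERIV (\<lambda>t. W x t + 2 * B * t) s :> y \<and> 0 \<le> y" using D by (intro exI[of _ "drift r h W x s + 2 * B"]) auto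
  next
    show "continuous_on {0..t} (\<lambda>t. W x t + 2 * B * t)"
      using discrete_solutionD(2)[OF W x]
      by (intro continuous_intros) (auto intro: continuous_on_subset)
  qed
  then show ?thesis using discrete_solutionD(1)[OF W x] by simp
qed

text \<open>
  The right-hand side is a strict supersolution of the scheme: the difference quotients of
  \<open>\<lambda>x. L * \<bar>x - z\<bar>\<close> are at most \<open>L\<close>, so its drift is at most \<open>2 * B * (exp L - 1)\<close>, which is less than
  its speed \<open>2 * B * exp L\<close>. The maximum of the difference is thus attained at time \<open>0\<close>.
\<close>

lemma discrete_barrier:
  assumes W: "discrete_solution \<Phi>p \<Phi>m w0 a b r h W" and h: "0 < h"
    and w0: "\<And>x. x \<in> {a..b} \<Longrightarrow> w0 x \<le> c + L * \<bar>x - z\<bar>" and L: "0 \<le> L"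
    and x: "x \<in> grid a b r h" and t: "0 \<le> t"
  shows "W x t \<le> c + L * \<bar>x - z\<bar> + 2 * B * exp L * t"
proof -
  define f where "f = (\<lambda>(x, t). W x t - L * \<bar>x - z\<bar> - 2 * B * exp L * t)"
  have "continuous_on (grid a b r h \<times> {0..t}) f"
    using discrete_solution_continuous[OF W h, of t]
    unfolding f_def case_prod_unfold by (intro continuous_intros)
  moreover have "compact (grid a b r h \<times> {0..t})"
    by (simp add: compact_Times finite_imp_compact finite_grid h)
  moreover have "grid a b r h \<times> {0..t} \<noteq> {}" using x t by auto
  ultimately obtain q where q: "q \<in> grid a b r h \<times> {0..t}"
    and qmax: "\<And>q'. q' \<in> grid a b r h \<times> {0..t} \<Longrightarrow> f q' \<le> f q"
    using continuous_attains_sup[of "grid a b r h \<times> {0..t}" f] by blast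
  obtain y s where q_eq: "q = (y, s)" by force
  have y: "y \<in> grid a b r h" and s: "0 \<le> s" "s \<le> t" using q q_eq by auto
  have yab: "y \<in> {a..b}" using y grid_subset by blast
  have "s = 0"
  proof (rule ccontr)
    assume "s \<noteq> 0"
    then have s0: "0 < s" using s by simp
    have "((\<lambda>t. W y t - L * \<bar>y - z\<bar> - 2 * B * exp L * t) has_real_derivative
        drift r h W y s - 2 * B * exp L) (at s)"
      using discrete_solutionD(3)[OF W y s0] by (auto intro!: derivative_eq_intros)
    then have "0 \<le> drift r h W y s - 2 * B * exp L"
    proof (rule deriv_nonneg_at_right_max)
      fix s' assume "0 \<le> s'" "s' \<le> s"
      then show "W y s' - L * \<bar>y - z\<bar> - 2 * B * exp L * s' \<le> W y s - L * \<bar>y - z\<bar> - 2 * B * exp L * s"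
        using qmax[of "(y, s')"] y s by (auto simp: f_def q_eq)
    qed fact
    moreover have "drift r h W y s \<le> flux \<Phi>p \<Phi>m y L L"
    proof (rule drift_le_flux[OF yab h])
      have *: "W y' s - W y s \<le> h * L" if "y' \<in> grid a b r h" "\<bar>y' - y\<bar> \<le> h" for y'
      proof -
        have "W y' s - W y s \<le> L * (\<bar>y' - z\<bar> - \<bar>y - z\<bar>)"
          using qmax[of "(y', s)"] that s by (auto simp: f_def q_eq algebra_simps)
        also have "\<dots> \<le> L * h" using that L by (intro mult_left_mono) auto
        finally show ?thesis by (simp add: mult.commute)
      qed
      show "y + h \<in> grid a b r h \<Longrightarrow> W (y + h) s - W y s \<le> h * L" using *[of "y + h"] h by auto
      show "y - h \<in> grid a b r h \<Longrightarrow> W (y - h) s - W y s \<le> h * L" using *[of "y - h"] h by auto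
    qed (use L in auto)
    moreover have "flux \<Phi>p \<Phi>m y L L \<le> B * (exp L - 1) + B * (exp L - 1)"
      unfolding flux_def using p_bounds[OF yab] m_bounds[OF yab] L
      by (intro add_mono mult_right_mono) auto
    ultimately show False using B_pos by (auto simp: algebra_simps)
  qed
  then have "f q \<le> c" using w0[OF yab] discrete_solutionD(1)[OF W y] by (simp add: f_def q_eq)
  moreover have "f (x, t) \<le> f q" using x t by (intro qmax) auto
  ultimately show ?thesis by (simp add: f_def)
qed

text \<open>
  The upper bound is the barrier with \<open>L = 0\<close>. What matters is that the bound depends neither on \<open>h\<close>
  nor on \<open>r\<close>.
\<close>

lemma discrete_bounded:
  assumes w0: "\<And>x. x \<in> {a..b} \<Longrightarrow> \<bar>w0 x\<bar> \<le> N"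
    and W: "discrete_solution \<Phi>p \<Phi>m w0 a b r h W" and h: "0 < h"
    and x: "x \<in> grid a b r h" and t: "0 \<le> t" "t \<le> T"
  shows "\<bar>W x t\<bar> \<le> N + 2 * B * T"
proof -
  have "x \<in> {a..b}" using x grid_subset by blast
  then have w0x: "\<bar>w0 x\<bar> \<le> N" by (rule w0)
  have "2 * B * t \<le> 2 * B * T" using t B_pos by auto
  moreover have "W x t \<le> N + 0 * \<bar>x - 0\<bar> + 2 * B * exp 0 * t"
    using w0 by (intro discrete_barrier[OF W h _ _ x t(1)]) (auto simp: abs_le_iff)
  moreover have "w0 x - 2 * B * t \<le> W x t" by (rule discrete_lower_bound[OF W x t(1)])
  ultimately show ?thesis using w0x by (auto simp: abs_le_iff)
qed

text \<open>
  A continuous \<open>w0\<close> need not be Lipschitz, but for every accuracy and every base point \<open>z\<close> it lies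
  below a cone with vertex slightly above \<open>w0 z\<close>, with an opening \<open>L\<close> that does not depend on \<open>z\<close>. The barrier
  started from that cone controls the discrete solution at \<open>z\<close> from above; the control from below is
  immediate from the bound on the drift.
\<close>

lemma discrete_initial_layer:
  assumes w0: "continuous_on {a..b} w0" and \<sigma>: "0 < \<sigma>"
  shows "\<exists>\<rho>>0. \<forall>r h W x y t. discrete_solution \<Phi>p \<Phi>m w0 a b r h W \<longrightarrow> 0 < h \<longrightarrow>
           x \<in> grid a b r h \<longrightarrow> y \<in> {a..b} \<longrightarrow> \<bar>x - y\<bar> \<le> \<rho> \<longrightarrow> 0 \<le> t \<longrightarrow> t \<le> \<rho> \<longrightarrow>
           \<bar>W x t - w0 y\<bar> \<le> \<sigma>"
proof -
  have "uniformly_continuous_on {a..b} w0"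
    using w0 by (intro compact_uniformly_continuous) auto
  then obtain d where d: "d > 0"
    and dw: "\<And>x y. x \<in> {a..b} \<Longrightarrow> y \<in> {a..b} \<Longrightarrow> \<bar>x - y\<bar> < d \<Longrightarrow> \<bar>w0 x - w0 y\<bar> < \<sigma> / 3"
    using \<sigma> unfolding uniformly_continuous_on_def dist_real_def
    by (metis divide_pos_pos zero_less_numeral abs_minus_commute)
  have "bounded (w0 ` {a..b})"
    using w0 by (intro compact_imp_bounded compact_continuous_image) auto
  then obtain N where N: "\<And>x. x \<in> {a..b} \<Longrightarrow> \<bar>w0 x\<bar> \<le> N"
    by (auto simp: bounded_iff simp del: atLeastAtMost_iff)
  have N0: "0 \<le> N" using N[of a] ab by auto
  define L where "L = 2 * N / d"
  have L0: "0 \<le> L" using N0 d by (simp add: L_def)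
  \<comment> \<open>points at distance less than \<open>d\<close> are covered by uniform continuity, the others by
     \<open>L * d = 2 * N\<close>\<close>
  have Lip: "w0 x \<le> w0 z + \<sigma> / 3 + L * \<bar>x - z\<bar>" if "x \<in> {a..b}" "z \<in> {a..b}" for x z
  proof (cases "\<bar>x - z\<bar> < d")
    case True
    then show ?thesis using dw[OF that True] mult_nonneg_nonneg[OF L0, of "\<bar>x - z\<bar>"] by linarith
  next
    case False
    then have "L * d \<le> L * \<bar>x - z\<bar>" using L0 by (intro mult_left_mono) auto
    moreover have "L * d = 2 * N" using d by (simp add: L_def)
    ultimately show ?thesis using N[OF that(1)] N[OF that(2)] \<sigma> by linarith
  qed
  define C where "C = 2 * B * exp L"
  have C: "0 < C" "2 * B \<le> C" using B_pos L0 by (auto simp: C_def)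
  define \<rho> where "\<rho> = min (d / 2) (\<sigma> / (3 * C))"
  show ?thesis
  proof (intro exI[of _ \<rho>] conjI allI impI)
    show "0 < \<rho>" using d \<sigma> C by (simp add: \<rho>_def)
    fix r h W x y t
    assume W: "discrete_solution \<Phi>p \<Phi>m w0 a b r h W" and h: "0 < h" and x: "x \<in> grid a b r h"
      and y: "y \<in> {a..b}" and xy: "\<bar>x - y\<bar> \<le> \<rho>" and t: "0 \<le> t" "t \<le> \<rho>"
    have xab: "x \<in> {a..b}" using x grid_subset by blast
    have "\<bar>x - y\<bar> < d" using xy d by (auto simp: \<rho>_def)
    then have 1: "\<bar>w0 x - w0 y\<bar> < \<sigma> / 3" by (rule dw[OF xab y])
    have "C * t \<le> C * (\<sigma> / (3 * C))" using t C by (intro mult_left_mono) (auto simp: \<rho>_def)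
    then have 2: "C * t \<le> \<sigma> / 3" using C by simp
    have "W x t \<le> w0 x + \<sigma> / 3 + L * \<bar>x - x\<bar> + 2 * B * exp L * t"
      by (rule discrete_barrier[OF W h Lip[OF _ xab] L0 x t(1)])
    then have 3: "W x t \<le> w0 x + \<sigma> / 3 + C * t" by (simp add: C_def)
    have "2 * B * t \<le> C * t" using C t by (intro mult_right_mono) auto
    with discrete_lower_bound[OF W x t(1)] have "w0 x - C * t \<le> W x t" by simp
    then show "\<bar>W x t - w0 y\<bar> \<le> \<sigma>" using 1 2 3 \<sigma> by linarith
  qed
qed

end


section \<open>Inequalities at a doubled maximum\<close>

text \<open>
  The penalisation parameters: \<open>\<epsilon>\<close> and \<open>\<delta>\<close> couple the two space and the two time variables, \<open>\<kappa>\<close> is the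
  strength of the boundary correction, \<open>\<theta>\<close> an upper bound for the consistency error of the scheme, and
  \<open>g\<close> the time penalty.
\<close>

locale doubling = intensities +
  fixes \<epsilon> \<delta> \<kappa> \<theta> \<eta> T :: real and g g' :: "real \<Rightarrow> real"
  assumes eps: "0 < \<epsilon>" and del: "0 < \<delta>" and kap: "0 < \<kappa>" and the: "0 \<le> \<theta>" and eta: "0 < \<eta>"
    and g_deriv: "\<And>t. (g has_real_derivative g' t) (at t)"
    and g'_cont: "continuous_on UNIV g'"
    and g'_ge: "\<And>t. 0 \<le> t \<Longrightarrow> \<eta> \<le> g' t"
begin

definition mid :: real where "mid = (a + b) / 2"

text \<open>
  What one of the two points sees of the full penalty while the other one, \<open>(y, s)\<close>, is kept
  fixed. It serves as the test function.
\<close>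

definition pen :: "real \<Rightarrow> real \<Rightarrow> real \<Rightarrow> real \<Rightarrow> real" where
  "pen y s x t = (x - y)\<^sup>2 / (2 * \<epsilon>) + (t - s)\<^sup>2 / (2 * \<delta>) + \<kappa> * (x - mid)\<^sup>2 + g t"

text \<open>
  The derivative of the penalty in \<open>x\<close>.
\<close>

definition slope :: "real \<Rightarrow> real \<Rightarrow> real" where
  "slope y x = (x - y) / \<epsilon> + 2 * \<kappa> * (x - mid)"

text \<open>
  The only property of a subsolution that the doubling argument uses, in a form that is shared by viscosity
  subsolutions on \<open>[a, b]\<close> and discrete solutions on the grid: the differential inequality, tested with
  penalties only, without boundary terms, and relaxed by \<open>\<theta>\<close>. The speed \<open>\<eta>\<close> comes from the
  time penalty. The definition for supersolutions is its mirror image; there the momentum is the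
  derivative of \<open>- pen\<close>.
\<close>

definition penalised_sub :: "real set \<Rightarrow> (real \<times> real \<Rightarrow> real) \<Rightarrow> bool" where
  "penalised_sub X u \<longleftrightarrow>
     (\<forall>x\<in>X. \<forall>t y s. 0 < t \<longrightarrow> t < T \<longrightarrow> y \<in> {a..b} \<longrightarrow>
        (\<forall>x'\<in>X. \<forall>t'\<in>{0..T}. u (x', t') - pen y s x' t' \<le> u (x, t) - pen y s x t) \<longrightarrow>
        (t - s) / \<delta> + \<eta> \<le> flux \<Phi>p \<Phi>m x (slope y x + \<theta>) (- slope y x + \<theta>))"

definition penalised_super :: "real set \<Rightarrow> (real \<times> real \<Rightarrow> real) \<Rightarrow> bool" where
  "penalised_super Y v \<longleftrightarrow>
     (\<forall>y\<in>Y. \<forall>s x t. 0 < s \<longrightarrow> s < T \<longrightarrow> x \<in> {a..b} \<longrightarrow>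
        (\<forall>y'\<in>Y. \<forall>s'\<in>{0..T}. v (y, s) + pen x t y s \<le> v (y', s') + pen x t y' s') \<longrightarrow>
        flux \<Phi>p \<Phi>m y (- slope x y - \<theta>) (slope x y - \<theta>) \<le> (t - s) / \<delta> - \<eta>)"

text \<open>
  At the ends of the interval the coupling term has the favourable sign, and the correction with \<open>\<kappa>\<close>
  makes the inequality strict. Hence the second argument of the minimum in the viscosity
  boundary conditions is positive, and that of the maximum is negative, so that the equation itself holds.
\<close>

lemma slope_left: "y \<in> {a..b} \<Longrightarrow> slope y a < 0"
proof -
  assume "y \<in> {a..b}"
  then have "(a - y) / \<epsilon> \<le> 0" using eps by (simp add: divide_nonpos_pos)
  moreover have "2 * \<kappa> * (a - mid) < 0" using kap ab by (intro mult_pos_neg) (auto simp: mid_def)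
  ultimately show ?thesis by (simp add: slope_def)
qed

lemma slope_right: "y \<in> {a..b} \<Longrightarrow> 0 < slope y b"
proof -
  assume "y \<in> {a..b}"
  then have "0 \<le> (b - y) / \<epsilon>" using eps by simp
  moreover have "0 < 2 * \<kappa> * (b - mid)" using kap ab by (intro mult_pos_pos) (auto simp: mid_def)
  ultimately show ?thesis by (simp add: slope_def)
qed

lemma g_has_derivative: "(g has_derivative (\<lambda>h. h * g' t)) (at t)"
proof -
  have "(\<lambda>h. h * g' t) = (*) (g' t)" by (simp add: fun_eq_iff mult.commute)
  then show ?thesis using g_deriv[of t] by (simp add: has_field_derivative_def)
qed

lemma pen_C1:
  "C1_with_partials (\<lambda>p. pen y s (fst p) (snd p)) (\<lambda>p. slope y (fst p))
     (\<lambda>p. (snd p - s) / \<delta> + g' (snd p))"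
  unfolding C1_with_partials_def
proof (intro conjI allI)
  show "continuous_on UNIV (\<lambda>p :: real \<times> real. slope y (fst p))"
    unfolding slope_def using eps by (intro continuous_intros) auto
  have "continuous_on UNIV (\<lambda>p :: real \<times> real. g' (snd p))"
    by (rule continuous_on_compose2[OF g'_cont]) (auto intro: continuous_intros)
  then show "continuous_on UNIV (\<lambda>p :: real \<times> real. (snd p - s) / \<delta> + g' (snd p))"
    using del by (intro continuous_intros) auto
  fix p :: "real \<times> real"
  have "((\<lambda>p. g (snd p)) has_derivative (\<lambda>h. snd h * g' (snd p))) (at p)"
    by (rule has_derivative_compose[OF _ g_has_derivative]) (auto intro: derivative_eq_intros)
  then have "((\<lambda>p. pen y s (fst p) (snd p)) has_derivative
      (\<lambda>h. (fst h * 2 * (fst p - y)) / (2 * \<epsilon>) + (snd h * 2 * (snd p - s)) / (2 * \<delta>)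
         + \<kappa> * (fst h * 2 * (fst p - mid)) + snd h * g' (snd p))) (at p)"
    unfolding pen_def using eps del
    by (auto intro!: derivative_eq_intros)
  moreover have "(\<lambda>h. (fst h * 2 * (fst p - y)) / (2 * \<epsilon>) + (snd h * 2 * (snd p - s)) / (2 * \<delta>)
         + \<kappa> * (fst h * 2 * (fst p - mid)) + snd h * g' (snd p))
      = (\<lambda>(d\<alpha>, dt). slope y (fst p) * d\<alpha> + ((snd p - s) / \<delta> + g' (snd p)) * dt)"
    using eps del by (intro ext) (simp add: slope_def case_prod_unfold field_simps)
  ultimately show "((\<lambda>p. pen y s (fst p) (snd p)) has_derivative
      (\<lambda>(d\<alpha>, dt). slope y (fst p) * d\<alpha> + ((snd p - s) / \<delta> + g' (snd p)) * dt)) (at p)"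
    by simp
qed

lemma C1_uminus:
  assumes "C1_with_partials \<phi> \<phi>x \<phi>t"
  shows "C1_with_partials (\<lambda>p. - \<phi> p) (\<lambda>p. - \<phi>x p) (\<lambda>p. - \<phi>t p)"
  unfolding C1_with_partials_def
proof (intro conjI allI)
  fix p
  have "((\<lambda>p. - \<phi> p) has_derivative (\<lambda>h. - (case h of (d\<alpha>, dt) \<Rightarrow> \<phi>x p * d\<alpha> + \<phi>t p * dt))) (at p)"
    using assms unfolding C1_with_partials_def by (intro has_derivative_minus) blast
  then show "((\<lambda>p. - \<phi> p) has_derivative (\<lambda>(d\<alpha>, dt). - \<phi>x p * d\<alpha> + - \<phi>t p * dt)) (at p)"
    by (simp add: case_prod_unfold)
qed (use assms in \<open>auto simp: C1_with_partials_def intro: continuous_on_minus\<close>)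

text \<open>
  The doubling works on a bounded time interval; an extremum over it is a local extremum in the
  sense of viscosity solutions as long as it is not attained at the final time.
\<close>

lemma eventually_before_horizon:
  fixes x t :: real
  assumes "0 < t" "t < T" "\<And>x' t'. x' \<in> {a..b} \<Longrightarrow> t' \<in> {0..T} \<Longrightarrow> P (x', t')"
  shows "\<forall>\<^sub>F q in at (x, t) within {a..b} \<times> {0..}. P q"
proof -
  have "open {q :: real \<times> real. snd q < T}"
    by (intro open_Collect_less continuous_intros)
  then show ?thesis
    unfolding eventually_at_topological using assms
    by (intro exI[of _ "{q. snd q < T}"]) auto
qed

lemma viscosity_imp_penalised_sub:
  assumes "viscosity_subsolution (hamiltonian \<Phi>p \<Phi>m) w0 a b w"
  shows "penalised_sub {a..b} w"
  unfolding penalised_sub_def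
proof (intro ballI allI impI)
  fix x t y s
  assume x: "x \<in> {a..b}" and t: "0 < t" "t < T" and y: "y \<in> {a..b}"
    and max: "\<forall>x'\<in>{a..b}. \<forall>t'\<in>{0..T}. w (x', t') - pen y s x' t' \<le> w (x, t) - pen y s x t"
  let ?\<phi> = "\<lambda>p. pen y s (fst p) (snd p)"
  have "local_max_on ({a..b} \<times> {0..}) (\<lambda>p. w p - ?\<phi> p) (x, t)"
    unfolding local_max_on_def
    using x t max by (intro conjI eventually_before_horizon) auto
  note * = assms[unfolded viscosity_subsolution_def, THEN conjunct2, THEN conjunct2,
      THEN spec, THEN spec, THEN spec, THEN spec, THEN spec, THEN mp, OF pen_C1,
      THEN mp, OF t(1), THEN mp, OF this]
  from * have *:
    "x \<in> {a<..<b} \<Longrightarrow> (t - s) / \<delta> + g' t - hamiltonian \<Phi>p \<Phi>m x (slope y x) \<le> 0"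
    "x = a \<Longrightarrow> min ((t - s) / \<delta> + g' t - hamiltonian \<Phi>p \<Phi>m a (slope y a)) (- slope y a) \<le> 0"
    "x = b \<Longrightarrow> min ((t - s) / \<delta> + g' t - hamiltonian \<Phi>p \<Phi>m b (slope y b)) (slope y b) \<le> 0"
    by auto
  have "(t - s) / \<delta> + g' t \<le> hamiltonian \<Phi>p \<Phi>m x (slope y x)"
    using * x slope_left[OF y] slope_right[OF y]
    by (cases "x = a"; cases "x = b") (auto simp: min_le_iff_disj)
  also have "\<dots> = flux \<Phi>p \<Phi>m x (slope y x) (- slope y x)" by (simp add: hamiltonian_def flux_def)
  also have "\<dots> \<le> flux \<Phi>p \<Phi>m x (slope y x + \<theta>) (- slope y x + \<theta>)"
    using the by (intro flux_mono x) auto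
  finally show "(t - s) / \<delta> + \<eta> \<le> flux \<Phi>p \<Phi>m x (slope y x + \<theta>) (- slope y x + \<theta>)"
    using g'_ge[of t] t by linarith
qed

lemma viscosity_imp_penalised_super:
  assumes "viscosity_supersolution (hamiltonian \<Phi>p \<Phi>m) w0 a b w"
  shows "penalised_super {a..b} w"
  unfolding penalised_super_def
proof (intro ballI allI impI)
  fix y s x t
  assume y: "y \<in> {a..b}" and s: "0 < s" "s < T" and x: "x \<in> {a..b}"
    and min: "\<forall>y'\<in>{a..b}. \<forall>s'\<in>{0..T}. w (y, s) + pen x t y s \<le> w (y', s') + pen x t y' s'"
  let ?\<phi> = "\<lambda>p. - pen x t (fst p) (snd p)"
  have "local_min_on ({a..b} \<times> {0..}) (\<lambda>p. w p - ?\<phi> p) (y, s)"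
    unfolding local_min_on_def
    using y s min by (intro conjI eventually_before_horizon) auto
  note * = assms[unfolded viscosity_supersolution_def, THEN conjunct2, THEN conjunct2,
      THEN spec, THEN spec, THEN spec, THEN spec, THEN spec, THEN mp, OF C1_uminus[OF pen_C1],
      THEN mp, OF s(1), THEN mp, OF this]
  from * have *:
    "y \<in> {a<..<b} \<Longrightarrow> - ((s - t) / \<delta> + g' s) - hamiltonian \<Phi>p \<Phi>m y (- slope x y) \<ge> 0"
    "y = a \<Longrightarrow> max (- ((s - t) / \<delta> + g' s) - hamiltonian \<Phi>p \<Phi>m a (- slope x a)) (slope x a) \<ge> 0"
    "y = b \<Longrightarrow> max (- ((s - t) / \<delta> + g' s) - hamiltonian \<Phi>p \<Phi>m b (- slope x b)) (- slope x b) \<ge> 0"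
    by auto
  have "flux \<Phi>p \<Phi>m y (- slope x y - \<theta>) (slope x y - \<theta>) \<le> flux \<Phi>p \<Phi>m y (- slope x y) (slope x y)"
    using the by (intro flux_mono y) auto
  also have "\<dots> = hamiltonian \<Phi>p \<Phi>m y (- slope x y)" by (simp add: hamiltonian_def flux_def)
  also have "\<dots> \<le> - ((s - t) / \<delta> + g' s)"
    using * y slope_left[OF x] slope_right[OF x]
    by (cases "y = a"; cases "y = b") (auto simp: le_max_iff_disj)
  finally show "flux \<Phi>p \<Phi>m y (- slope x y - \<theta>) (slope x y - \<theta>) \<le> (t - s) / \<delta> - \<eta>"
    using g'_ge[of s] s by (simp add: diff_divide_distrib)
qed

text \<open>
  The quadratic penalty has difference quotients that differ from its slope by a
  constant of order \<open>h\<close>, for either sign of \<open>h\<close>.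
\<close>

lemma pen_step:
  "pen y s (x + h) t - pen y s x t = h * (slope y x + (h / (2 * \<epsilon>) + \<kappa> * h))"
  using eps by (simp add: pen_def slope_def power2_eq_square field_simps)

lemma pen_time_deriv: "((\<lambda>t. pen y s x t) has_real_derivative (t - s) / \<delta> + g' t) (at t)"
  unfolding pen_def using g_deriv[of t] del
  by (auto intro!: derivative_eq_intros simp: field_simps)

text \<open>
  A grid point without right neighbour lies within \<open>h\<close> of \<open>b\<close>. There the coupling may have the wrong
  sign, but only by \<open>h / \<epsilon>\<close>, which the correction with \<open>\<kappa>\<close> absorbs.
\<close>

lemma slope_near_right:
  assumes "y \<in> {a..b}" "b - h \<le> x" "h / \<epsilon> + 2 * \<kappa> * h \<le> \<kappa> * (b - a)"
  shows "0 \<le> slope y x"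
proof -
  have "(b - h - b) / \<epsilon> \<le> (x - y) / \<epsilon>" using assms eps by (intro divide_right_mono) auto
  moreover have "2 * \<kappa> * (b - h - mid) \<le> 2 * \<kappa> * (x - mid)"
    using assms kap by (intro mult_left_mono) auto
  moreover have "2 * \<kappa> * (b - h - mid) = \<kappa> * (b - a) - 2 * \<kappa> * h"
    by (simp add: mid_def field_simps)
  ultimately show ?thesis using assms(3) by (simp add: slope_def)
qed

lemma slope_near_left:
  assumes "y \<in> {a..b}" "x \<le> a + h" "h / \<epsilon> + 2 * \<kappa> * h \<le> \<kappa> * (b - a)"
  shows "slope y x \<le> 0"
proof -
  have "(x - y) / \<epsilon> \<le> (a + h - a) / \<epsilon>" using assms eps by (intro divide_right_mono) auto
  moreover have "2 * \<kappa> * (x - mid) \<le> 2 * \<kappa> * (a + h - mid)"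
    using assms kap by (intro mult_left_mono) auto
  moreover have "2 * \<kappa> * (a + h - mid) = - (\<kappa> * (b - a)) + 2 * \<kappa> * h"
    by (simp add: mid_def field_simps)
  ultimately show ?thesis using assms(3) by (simp add: slope_def)
qed

text \<open>
  At a maximum of \<open>W - pen\<close> over the grid, the difference quotients of \<open>W\<close> are bounded by those of the
  penalty, and the drift is monotone in them.
\<close>

lemma discrete_imp_penalised_sub:
  assumes W: "discrete_solution \<Phi>p \<Phi>m w0 a b r h W" and h: "0 < h"
    and h_theta: "h / (2 * \<epsilon>) + \<kappa> * h \<le> \<theta>" and h_bdry: "h / \<epsilon> + 2 * \<kappa> * h \<le> \<kappa> * (b - a)"
  shows "penalised_sub (grid a b r h) (\<lambda>(x, t). W x t)"
  unfolding penalised_sub_def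
proof (intro ballI allI impI, unfold split)
  fix x t y s
  assume x: "x \<in> grid a b r h" and t: "0 < t" "t < T" and y: "y \<in> {a..b}"
    and max: "\<forall>x'\<in>grid a b r h. \<forall>t'\<in>{0..T}. W x' t' - pen y s x' t' \<le> W x t - pen y s x t"
  have xab: "x \<in> {a..b}" using x grid_subset by blast
  have "((\<lambda>t. W x t - pen y s x t) has_real_derivative
      drift r h W x t - ((t - s) / \<delta> + g' t)) (at t)"
    by (intro DERIV_diff discrete_solutionD(3)[OF W x t(1)] pen_time_deriv)
  then have "0 \<le> drift r h W x t - ((t - s) / \<delta> + g' t)"
    by (rule deriv_nonneg_at_right_max) (use max x t in auto)
  moreover have "drift r h W x t \<le> flux \<Phi>p \<Phi>m x (slope y x + \<theta>) (- slope y x + \<theta>)"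
  proof (rule drift_le_flux[OF xab h])
    have h\<theta>: "h * (h / (2 * \<epsilon>) + \<kappa> * h) \<le> h * \<theta>" using h h_theta by (intro mult_left_mono) auto
    show "W (x + h) t - W x t \<le> h * (slope y x + \<theta>)" if "x + h \<in> grid a b r h"
    proof -
      have "W (x + h) t - W x t \<le> pen y s (x + h) t - pen y s x t"
        using max[rule_format, OF that, of t] t by auto
      then show ?thesis using h\<theta> by (simp add: pen_step distrib_left)
    qed
    show "W (x - h) t - W x t \<le> h * (- slope y x + \<theta>)" if "x - h \<in> grid a b r h"
    proof -
      have "W (x - h) t - W x t \<le> pen y s (x + (- h)) t - pen y s x t"
        using max[rule_format, OF that, of t] t by auto
      then show ?thesis using h\<theta> unfolding pen_step by (simp add: algebra_simps)
    qed
    show "0 \<le> slope y x + \<theta>" if "x + h \<notin> grid a b r h"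
      using slope_near_right[OF y _ h_bdry, of x] that grid_step[OF x h] the by auto
    show "0 \<le> - slope y x + \<theta>" if "x - h \<notin> grid a b r h"
      using slope_near_left[OF y _ h_bdry, of x] that grid_step[OF x h] the by auto
  qed
  ultimately show "(t - s) / \<delta> + \<eta> \<le> flux \<Phi>p \<Phi>m x (slope y x + \<theta>) (- slope y x + \<theta>)"
    using g'_ge[of t] t by linarith
qed

lemma discrete_imp_penalised_super:
  assumes W: "discrete_solution \<Phi>p \<Phi>m w0 a b r h W" and h: "0 < h"
    and h_theta: "h / (2 * \<epsilon>) + \<kappa> * h \<le> \<theta>" and h_bdry: "h / \<epsilon> + 2 * \<kappa> * h \<le> \<kappa> * (b - a)"
  shows "penalised_super (grid a b r h) (\<lambda>(x, t). W x t)"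
  unfolding penalised_super_def
proof (intro ballI allI impI, unfold split)
  fix y s x t
  assume y: "y \<in> grid a b r h" and s: "0 < s" "s < T" and x: "x \<in> {a..b}"
    and min: "\<forall>y'\<in>grid a b r h. \<forall>s'\<in>{0..T}. W y s + pen x t y s \<le> W y' s' + pen x t y' s'"
  have yab: "y \<in> {a..b}" using y grid_subset by blast
  have "((\<lambda>s. - (W y s + pen x t y s)) has_real_derivative
      - (drift r h W y s + ((s - t) / \<delta> + g' s))) (at s)"
    by (intro DERIV_minus DERIV_add discrete_solutionD(3)[OF W y s(1)] pen_time_deriv)
  then have "0 \<le> - (drift r h W y s + ((s - t) / \<delta> + g' s))"
  proof (rule deriv_nonneg_at_right_max)
    fix s' assume "0 \<le> s'" "s' \<le> s"
    then have "W y s + pen x t y s \<le> W y s' + pen x t y s'" using min y s by auto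
    then show "- (W y s' + pen x t y s') \<le> - (W y s + pen x t y s)" by simp
  qed fact
  moreover have "flux \<Phi>p \<Phi>m y (- slope x y - \<theta>) (slope x y - \<theta>) \<le> drift r h W y s"
  proof (rule drift_ge_flux[OF yab h])
    have h\<theta>: "h * (h / (2 * \<epsilon>) + \<kappa> * h) \<le> h * \<theta>" using h h_theta by (intro mult_left_mono) auto
    show "h * (- slope x y - \<theta>) \<le> W (y + h) s - W y s" if "y + h \<in> grid a b r h"
    proof -
      have "- (pen x t (y + h) s - pen x t y s) \<le> W (y + h) s - W y s"
        using min[rule_format, OF that, of s] s by auto
      then show ?thesis using h\<theta> unfolding pen_step by (simp add: algebra_simps)
    qed
    show "h * (slope x y - \<theta>) \<le> W (y - h) s - W y s" if "y - h \<in> grid a b r h"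
    proof -
      have "- (pen x t (y + (- h)) s - pen x t y s) \<le> W (y - h) s - W y s"
        using min[rule_format, OF that, of s] s by auto
      then show ?thesis using h\<theta> unfolding pen_step by (simp add: algebra_simps)
    qed
    show "- slope x y - \<theta> \<le> 0" if "y + h \<notin> grid a b r h"
      using slope_near_right[OF x _ h_bdry, of y] that grid_step[OF y h] the by auto
    show "slope x y - \<theta> \<le> 0" if "y - h \<notin> grid a b r h"
      using slope_near_left[OF x _ h_bdry, of y] that grid_step[OF y h] the by auto
  qed
  ultimately show "flux \<Phi>p \<Phi>m y (- slope x y - \<theta>) (slope x y - \<theta>) \<le> (t - s) / \<delta> - \<eta>"
    using g'_ge[of s] s by (simp add: diff_divide_distrib)
qed

text \<open>
  The core of the argument. The assumptions on the constants reflect the order in which they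
  are chosen: \<open>\<rho>\<close> is the width of the initial layer and determines \<open>\<delta>\<close>; the bound \<open>E\<close> on the exponentials
  depends on \<open>\<rho>\<close> and \<open>\<delta>\<close>, but not on \<open>\<epsilon>\<close>; \<open>\<mu>\<close> bounds the difference of the momenta and \<open>\<omega>\<close> the oscillation of the intensities
  at distance \<open>\<rho>1\<close>, which determines \<open>\<epsilon>\<close>.
\<close>

lemma penalised_comparison:
  assumes X: "compact X" "X \<subseteq> {a..b}" and Y: "compact Y" "Y \<subseteq> {a..b}"
    and u_cont: "continuous_on (X \<times> {0..T}) u" and v_cont: "continuous_on (Y \<times> {0..T}) v"
    and u_bound: "\<And>x t. x \<in> X \<Longrightarrow> t \<in> {0..T} \<Longrightarrow> \<bar>u (x, t)\<bar> \<le> M"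
    and v_bound: "\<And>y s. y \<in> Y \<Longrightarrow> s \<in> {0..T} \<Longrightarrow> \<bar>v (y, s)\<bar> \<le> M"
    and sub: "penalised_sub X u" and super: "penalised_super Y v"
    and g_nonneg: "\<And>t. 0 \<le> t \<Longrightarrow> 0 \<le> g t" and g_T: "2 * M \<le> g T"
    and u_init: "\<And>x y t. x \<in> X \<Longrightarrow> y \<in> {a..b} \<Longrightarrow> \<bar>x - y\<bar> \<le> \<rho> \<Longrightarrow> 0 \<le> t \<Longrightarrow> t \<le> \<rho>
                   \<Longrightarrow> \<bar>u (x, t) - w0 y\<bar> \<le> \<sigma> / 4"
    and v_init: "\<And>x y t. x \<in> Y \<Longrightarrow> y \<in> {a..b} \<Longrightarrow> \<bar>x - y\<bar> \<le> \<rho> \<Longrightarrow> 0 \<le> t \<Longrightarrow> t \<le> \<rho>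
                   \<Longrightarrow> \<bar>v (x, t) - w0 y\<bar> \<le> \<sigma> / 4"
    and \<omega>: "\<And>x y. x \<in> {a..b} \<Longrightarrow> y \<in> {a..b} \<Longrightarrow> \<bar>x - y\<bar> \<le> \<rho>1
              \<Longrightarrow> \<bar>\<Phi>p x - \<Phi>p y\<bar> \<le> \<omega> \<and> \<bar>\<Phi>m x - \<Phi>m y\<bar> \<le> \<omega>"
    and \<rho>: "0 \<le> \<rho>1" "\<rho>1 \<le> \<rho>" "4 * M * \<delta> \<le> \<rho>\<^sup>2" "4 * M * \<epsilon> \<le> \<rho>1\<^sup>2"
    and E: "(\<rho> / \<delta> + 2 * B) / c0 \<le> E" and \<mu>: "2 * \<kappa> * (b - a) + 2 * \<theta> \<le> \<mu>"
    and gap: "B * E * (exp \<mu> - 1) + \<omega> * (E + 1) < \<eta>"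
    and \<sigma>: "0 < \<sigma>" and z: "z \<in> X" "z \<in> Y" and t0: "0 \<le> t0" "t0 \<le> T"
    and z_pen: "2 * \<kappa> * (z - mid)\<^sup>2 + 2 * g t0 \<le> \<sigma> / 2"
  shows "u (z, t0) - v (z, t0) \<le> \<sigma>"
proof (rule ccontr)
  assume "\<not> ?thesis"
  then have contra: "\<sigma> < u (z, t0) - v (z, t0)" by simp
  define \<Psi> where "\<Psi> = (\<lambda>((x, t), (y, s)). u (x, t) - v (y, s) - (x - y)\<^sup>2 / (2 * \<epsilon>)
      - (t - s)\<^sup>2 / (2 * \<delta>) - \<kappa> * (x - mid)\<^sup>2 - \<kappa> * (y - mid)\<^sup>2 - g t - g s)"
  let ?D = "(X \<times> {0..T}) \<times> (Y \<times> {0..T})"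
  have "compact ?D" using X Y by (intro compact_Times) auto
  moreover have "?D \<noteq> {}" using z t0 by auto
  moreover have "continuous_on ?D \<Psi>"
  proof -
    have g_cont: "continuous_on UNIV g"
      using g_deriv by (meson DERIV_isCont continuous_at_imp_continuous_on)
    have "continuous_on ?D (\<lambda>p. u (fst p))" "continuous_on ?D (\<lambda>p. v (snd p))"
      by (auto intro!: continuous_on_compose2[OF u_cont] continuous_on_compose2[OF v_cont] continuous_intros)
    moreover have "continuous_on ?D (\<lambda>p. g (snd (fst p)))" "continuous_on ?D (\<lambda>p. g (snd (snd p)))"
      by (auto intro!: continuous_on_compose2[OF g_cont] continuous_intros)
    ultimately show ?thesis
      unfolding \<Psi>_def case_prod_unfold using eps del by (auto intro!: continuous_intros)
  qed
  ultimately obtain q where q: "q \<in> ?D" and qmax: "\<And>q'. q' \<in> ?D \<Longrightarrow> \<Psi> q' \<le> \<Psi> q"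
    using continuous_attains_sup[of ?D \<Psi>] by blast
  obtain x t y s where q_eq: "q = ((x, t), (y, s))" by (metis surj_pair)
  have x: "x \<in> X" "x \<in> {a..b}" and y: "y \<in> Y" "y \<in> {a..b}" and t: "0 \<le> t" "t \<le> T" and s: "0 \<le> s" "s \<le> T"
    using q X Y by (auto simp: q_eq)
  have "\<sigma> / 2 < \<Psi> ((z, t0), (z, t0))" using contra z_pen by (simp add: \<Psi>_def)
  also have "\<dots> \<le> \<Psi> q" using z t0 by (intro qmax) auto
  finally have \<Psi>q: "\<sigma> / 2 < u (x, t) - v (y, s) - (x - y)\<^sup>2 / (2 * \<epsilon>)
      - (t - s)\<^sup>2 / (2 * \<delta>) - \<kappa> * (x - mid)\<^sup>2 - \<kappa> * (y - mid)\<^sup>2 - g t - g s"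
    by (simp add: \<Psi>_def q_eq)
  have nonneg: "0 \<le> (x - y)\<^sup>2 / (2 * \<epsilon>)" "0 \<le> (t - s)\<^sup>2 / (2 * \<delta>)" "0 \<le> \<kappa> * (x - mid)\<^sup>2"
    "0 \<le> \<kappa> * (y - mid)\<^sup>2" "0 \<le> g t" "0 \<le> g s"
    using eps del kap t s by (auto intro!: g_nonneg)
  have uv: "u (x, t) - v (y, s) \<le> 2 * M"
    using u_bound[OF x(1), of t] v_bound[OF y(1), of s] t s by auto
  have "(x - y)\<^sup>2 / (2 * \<epsilon>) \<le> 2 * M" "(t - s)\<^sup>2 / (2 * \<delta>) \<le> 2 * M"
    using \<Psi>q nonneg uv \<sigma> by linarith+
  then have "(x - y)\<^sup>2 \<le> 4 * M * \<epsilon>" "(t - s)\<^sup>2 \<le> 4 * M * \<delta>"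
    using eps del by (auto simp: field_simps)
  then have "(x - y)\<^sup>2 \<le> \<rho>1\<^sup>2" "(t - s)\<^sup>2 \<le> \<rho>\<^sup>2" using \<rho> by linarith+
  then have xy: "\<bar>x - y\<bar> \<le> \<rho>1" and ts: "\<bar>t - s\<bar> \<le> \<rho>"
    using \<rho> by (auto simp flip: abs_le_square_iff)
  have gap2: "\<sigma> / 2 < u (x, t) - v (y, s)" using \<Psi>q nonneg by linarith
  have "t \<noteq> T" "s \<noteq> T" using \<Psi>q nonneg uv \<sigma> g_T by auto
  then have tT: "t < T" "s < T" using t s by auto
  have "t \<noteq> 0"
  proof
    assume "t = 0"
    then have "\<bar>u (x, t) - w0 x\<bar> \<le> \<sigma> / 4" "\<bar>v (y, s) - w0 x\<bar> \<le> \<sigma> / 4"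
      using xy ts s \<rho> u_init[OF x(1) x(2), of t] v_init[OF y(1) x(2), of s] by auto
    then show False using gap2 by linarith
  qed
  moreover have "s \<noteq> 0"
  proof
    assume "s = 0"
    then have "\<bar>u (x, t) - w0 y\<bar> \<le> \<sigma> / 4" "\<bar>v (y, s) - w0 y\<bar> \<le> \<sigma> / 4"
      using xy ts t \<rho> u_init[OF x(1) y(2), of t] v_init[OF y(1) y(2), of s] by auto
    then show False using gap2 by linarith
  qed
  ultimately have t_pos: "0 < t" and s_pos: "0 < s" using t s by auto
  \<comment> \<open>the maximum point lies in the open time interval, so both inequalities apply\<close>
  have sub': "(t - s) / \<delta> + \<eta> \<le> flux \<Phi>p \<Phi>m x (slope y x + \<theta>) (- slope y x + \<theta>)"
  proof (rule sub[unfolded penalised_sub_def, rule_format, OF x(1) t_pos tT(1) y(2)])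
    fix x' t' assume "x' \<in> X" "t' \<in> {0..T}"
    then have "\<Psi> ((x', t'), (y, s)) \<le> \<Psi> q" using y s by (intro qmax) auto
    then show "u (x', t') - pen y s x' t' \<le> u (x, t) - pen y s x t"
      by (simp add: \<Psi>_def q_eq pen_def)
  qed
  have super': "flux \<Phi>p \<Phi>m y (- slope x y - \<theta>) (slope x y - \<theta>) \<le> (t - s) / \<delta> - \<eta>"
  proof (rule super[unfolded penalised_super_def, rule_format, OF y(1) s_pos tT(2) x(2)])
    fix y' s' assume "y' \<in> Y" "s' \<in> {0..T}"
    then have "\<Psi> ((x, t), (y', s')) \<le> \<Psi> q" using x t by (intro qmax) auto
    then show "v (y, s) + pen x t y s \<le> v (y', s') + pen x t y' s'"
      by (simp add: \<Psi>_def q_eq pen_def power2_commute)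
  qed
  have "(t - s) / \<delta> - \<eta> + 2 * B \<le> \<rho> / \<delta> + 2 * B"
    using ts eta divide_right_mono[of "t - s" \<rho> \<delta>] del by linarith
  then have E': "((t - s) / \<delta> - \<eta> + 2 * B) / c0 \<le> E"
    using E c0 divide_right_mono[of _ _ c0] order_trans by (metis less_imp_le)
  \<comment> \<open>coercivity is used for \<open>v\<close>, whose inequality bounds the flux from above\<close>
  have expE: "exp (- slope x y - \<theta>) \<le> E" "exp (slope x y - \<theta>) \<le> E"
    using exp_le_of_flux_le[OF y(2) super'] E' by linarith+
  have slopes: "slope y x + slope x y = 2 * \<kappa> * (x + y - 2 * mid)"
    by (simp add: slope_def diff_divide_distrib algebra_simps)
  have "2 * mid = a + b" by (simp add: mid_def)
  then have "\<bar>x + y - 2 * mid\<bar> \<le> b - a" using x(2) y(2) by (auto simp: abs_le_iff)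
  then have "2 * \<kappa> * \<bar>x + y - 2 * mid\<bar> \<le> 2 * \<kappa> * (b - a)"
    using kap by (intro mult_left_mono) auto
  then have "\<bar>slope y x + slope x y\<bar> \<le> 2 * \<kappa> * (b - a)"
    unfolding slopes using kap by (simp add: abs_mult)
  then have \<mu>s: "slope y x + \<theta> \<le> (- slope x y - \<theta>) + \<mu>" "- slope y x + \<theta> \<le> (slope x y - \<theta>) + \<mu>"
    using \<mu> by linarith+
  have \<mu>0: "0 \<le> \<mu>" 
  proof -
    have "0 \<le> 2 * \<kappa> * (b - a)" using kap ab by simp
    then show ?thesis using \<mu> the by linarith
  qed
  have p_A: "0 \<le> \<Phi>p x" and m_A: "0 \<le> \<Phi>m x"
    using p_bounds[OF x(2)] m_bounds[OF x(2)] c0 by auto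
  define K where "K = B * E * (exp \<mu> - 1) + \<omega> * (E + 1)"
  note \<omega>xy = \<omega>[OF x(2) y(2) xy]
  have "flux \<Phi>p \<Phi>m x (slope y x + \<theta>) (- slope y x + \<theta>) - flux \<Phi>p \<Phi>m y (- slope x y - \<theta>) (slope x y - \<theta>)
      \<le> 2 * K"
    unfolding K_def
    using add_mono[OF
        one_flux_gap[OF p_A p_bounds[OF x(2), THEN conjunct2] \<omega>xy[THEN conjunct1] \<mu>s(1) \<mu>0 expE(1)]
        one_flux_gap[OF m_A m_bounds[OF x(2), THEN conjunct2] \<omega>xy[THEN conjunct2] \<mu>s(2) \<mu>0 expE(2)]]
    unfolding flux_def add_diff_add mult_2 .
  moreover have "K < \<eta>" using gap unfolding K_def .
  ultimately show False using sub' super' by linarith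
qed

end


section \<open>Uniform convergence\<close>

context intensities
begin

text \<open>
  The comparison is applied twice, with the discrete solution as sub- and as supersolution. The mesh
  bound \<open>h0\<close> precedes the quantifiers over \<open>r\<close> and \<open>W\<close>: the relaxed limits let \<open>r\<close> vary with \<open>h\<close>.
\<close>

lemma discrete_uniformly_close:
  assumes \<Phi>p_cont: "continuous_on {a..b} \<Phi>p" and \<Phi>m_cont: "continuous_on {a..b} \<Phi>m"
    and w0_cont: "continuous_on {a..b} w0"
    and w: "viscosity_solution (hamiltonian \<Phi>p \<Phi>m) w0 a b w"
    and \<sigma>: "0 < \<sigma>" and T0: "0 \<le> T0"
  shows "\<exists>h0>0. \<forall>r h W x t. discrete_solution \<Phi>p \<Phi>m w0 a b r h W \<longrightarrow> 0 < h \<longrightarrow> h < h0 \<longrightarrow>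
           x \<in> grid a b r h \<longrightarrow> 0 \<le> t \<longrightarrow> t \<le> T0 \<longrightarrow> \<bar>W x t - w (x, t)\<bar> \<le> \<sigma>"
proof -
  define T where "T = T0 + 1"
  have T: "0 < T" using T0 by (simp add: T_def)
  have sub: "viscosity_subsolution (hamiltonian \<Phi>p \<Phi>m) w0 a b w"
    and super: "viscosity_supersolution (hamiltonian \<Phi>p \<Phi>m) w0 a b w"
    and w_cont': "continuous_on ({a..b} \<times> {0..}) w"
    using w by (auto simp: viscosity_solution_def)
  have w_init: "w (x, 0) = w0 x" if "x \<in> {a..b}" for x
    using sub super that unfolding viscosity_subsolution_def viscosity_supersolution_def
    by (meson order_antisym)
  have w_cont: "continuous_on ({a..b} \<times> {0..T}) w"
    by (rule continuous_on_subset[OF w_cont']) auto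
  have cpt: "compact ({a..b} \<times> {0..T})" by (intro compact_Times) auto
  have "bounded (w ` ({a..b} \<times> {0..T}))"
    using compact_continuous_image[OF w_cont cpt] by (rule compact_imp_bounded)
  then obtain N1 where N1: "\<And>p. p \<in> {a..b} \<times> {0..T} \<Longrightarrow> \<bar>w p\<bar> \<le> N1"
    unfolding bounded_iff by (metis imageI real_norm_def)
  have N1_w0: "\<bar>w0 x\<bar> \<le> N1" if "x \<in> {a..b}" for x
    using N1[of "(x, 0)"] w_init[OF that] that T by auto
  have N1_nonneg: "0 \<le> N1" using N1_w0[of a] ab by auto
  define M where "M = N1 + 2 * B * T + 1"
  have BT: "0 \<le> 2 * B * T" using B_pos T by auto
  have M: "0 < M" using N1_nonneg BT by (simp add: M_def)
  have w_bound: "\<bar>w (x, t)\<bar> \<le> M" if "x \<in> {a..b}" "t \<in> {0..T}" for x t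
    using N1[of "(x, t)"] that BT by (auto simp: M_def)
  have W_bound: "\<bar>W x t\<bar> \<le> M"
    if "discrete_solution \<Phi>p \<Phi>m w0 a b r h W" "0 < h" "x \<in> grid a b r h" "t \<in> {0..T}" for r h W x t
    using discrete_bounded[OF N1_w0 that(1,2,3), where t = t and T = T] that(4) by (simp add: M_def)

  obtain \<rho>W where \<rho>W: "\<rho>W > 0"
    and W_layer: "\<And>r h W x y t. discrete_solution \<Phi>p \<Phi>m w0 a b r h W \<Longrightarrow> 0 < h \<Longrightarrow>
       x \<in> grid a b r h \<Longrightarrow> y \<in> {a..b} \<Longrightarrow> \<bar>x - y\<bar> \<le> \<rho>W \<Longrightarrow> 0 \<le> t \<Longrightarrow> t \<le> \<rho>W \<Longrightarrow>
       \<bar>W x t - w0 y\<bar> \<le> \<sigma> / 4"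
    using discrete_initial_layer[OF w0_cont, of "\<sigma> / 4"] \<sigma> by auto
  have "uniformly_continuous_on ({a..b} \<times> {0..T}) w"
    using w_cont cpt by (rule compact_uniformly_continuous)
  then obtain d where d: "d > 0"
    and dw: "\<And>p q. p \<in> {a..b} \<times> {0..T} \<Longrightarrow> q \<in> {a..b} \<times> {0..T} \<Longrightarrow> dist q p < d
       \<Longrightarrow> dist (w q) (w p) < \<sigma> / 4"
    unfolding uniformly_continuous_on_def using \<sigma> by (metis divide_pos_pos zero_less_numeral)
  define \<rho> where "\<rho> = min \<rho>W (min (d / 3) T)"
  have \<rho>: "0 < \<rho>" "\<rho> \<le> \<rho>W" "\<rho> \<le> d / 3" "\<rho> \<le> T" using \<rho>W d T by (auto simp: \<rho>_def)
  have w_layer: "\<bar>w (x, t) - w0 y\<bar> \<le> \<sigma> / 4"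
    if "x \<in> {a..b}" "y \<in> {a..b}" "\<bar>x - y\<bar> \<le> \<rho>" "0 \<le> t" "t \<le> \<rho>" for x y t
  proof -
    have "dist (x, t) (y, 0) \<le> \<bar>x - y\<bar> + \<bar>t\<bar>"
      using norm_Pair_le[of "x - y" t] by (simp add: dist_norm)
    also have "\<dots> < d" using that \<rho> d by linarith
    finally have "dist (w (x, t)) (w (y, 0)) < \<sigma> / 4"
      using that \<rho> T by (intro dw) auto
    then show ?thesis using w_init[OF that(2)] by (simp add: dist_real_def)
  qed

  \<comment> \<open>\<open>g\<close> equals \<open>2 * M\<close> at the final time \<open>T = T0 + 1\<close>, while its rate \<open>lam\<close> is so large that \<open>g\<close> is at
     most \<open>\<sigma> / 8\<close> up to \<open>T0\<close>; \<open>\<eta>\<close> is its derivative at time \<open>0\<close>\<close>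
  define lam where "lam = 16 * M / \<sigma>"
  have lam: "0 < lam" using M \<sigma> by (simp add: lam_def)
  define g where "g = (\<lambda>t. 2 * M * exp (lam * (t - T)))"
  define g' where "g' = (\<lambda>t. 2 * M * lam * exp (lam * (t - T)))"
  define \<eta> where "\<eta> = 2 * M * lam * exp (lam * (- T))"
  have \<eta>: "0 < \<eta>" using M lam by (simp add: \<eta>_def)
  have g_small: "g t \<le> \<sigma> / 8" if "t \<le> T0" for t
  proof -
    have "lam * (t - T) \<le> lam * (- 1)" using that lam by (intro mult_left_mono) (auto simp: T_def)
    then have "exp (lam * (t - T)) \<le> exp (- lam)" by simp
    also have "\<dots> \<le> 1 / lam"
    proof -
      have "lam \<le> exp lam" using exp_ge_add_one_self[of lam] by linarith
      then show ?thesis using lam by (simp add: exp_minus field_simps)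
    qed
    finally have "g t \<le> 2 * M * (1 / lam)" unfolding g_def using M by (intro mult_left_mono) auto
    also have "\<dots> = \<sigma> / 8" using M \<sigma> by (simp add: lam_def)
    finally show ?thesis .
  qed

  define \<delta> where "\<delta> = \<rho>\<^sup>2 / (4 * M)"
  have \<delta>: "0 < \<delta>" "4 * M * \<delta> = \<rho>\<^sup>2" using \<rho> M by (auto simp: \<delta>_def)
  define E where "E = (\<rho> / \<delta> + 2 * B) / c0"
  have E: "0 < E" using \<rho> \<delta> B_pos c0 by (simp add: E_def add_pos_pos)
  \<comment> \<open>chosen such that \<open>B * E * (exp \<mu> - 1) = \<eta> / 4\<close>\<close>
  define \<mu> where "\<mu> = ln (1 + \<eta> / (4 * B * E))"
  have \<eta>BE: "0 < \<eta> / (4 * B * E)" using \<eta> B_pos E by simp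
  have \<mu>: "0 < \<mu>" using \<eta>BE by (simp add: \<mu>_def)
  have "exp \<mu> - 1 = \<eta> / (4 * B * E)" using \<eta>BE by (simp add: \<mu>_def)
  then have BE\<mu>: "B * E * (exp \<mu> - 1) = \<eta> / 4" using B_pos E by simp
  define \<omega> where "\<omega> = \<eta> / (4 * (E + 1))"
  have \<omega>: "0 < \<omega>" "\<omega> * (E + 1) = \<eta> / 4" 
  proof -
    have "\<eta> / (4 * e) * e = \<eta> / 4" if "e \<noteq> 0" for e using that by simp
    then show "\<omega> * (E + 1) = \<eta> / 4" using E by (auto simp only: \<omega>_def)
  qed (use \<eta> E in \<open>simp add: \<omega>_def\<close>)
  \<comment> \<open>the first bound keeps the momenta within \<open>\<mu>\<close>, the second one the penalty below \<open>\<sigma> / 8\<close>\<close>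
  define \<kappa> where "\<kappa> = min (\<mu> / (4 * (b - a))) (\<sigma> / (8 * (b - a)\<^sup>2))"
  have \<kappa>: "0 < \<kappa>" using \<mu> \<sigma> ab by (simp add: \<kappa>_def)
  have scale: "k * d \<le> v / c" if "k \<le> v / (c * d)" "0 < d" "0 < c" for k v c d :: real
    using that by (simp add: field_simps)
  have \<kappa>\<mu>: "\<kappa> * (b - a) \<le> \<mu> / 4"
    by (rule scale) (use ab in \<open>auto simp: \<kappa>_def\<close>)
  have \<kappa>\<sigma>: "\<kappa> * (b - a)\<^sup>2 \<le> \<sigma> / 8"
    by (rule scale) (use ab in \<open>auto simp: \<kappa>_def\<close>)
  define \<theta> where "\<theta> = \<mu> / 4"

  have modulus: "\<exists>d>0. \<forall>x\<in>{a..b}. \<forall>y\<in>{a..b}. \<bar>x - y\<bar> < d \<longrightarrow> \<bar>f x - f y\<bar> < \<omega>"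
    if "continuous_on {a..b} f" for f
    using compact_uniformly_continuous[OF that] \<omega>(1)
    unfolding uniformly_continuous_on_def dist_real_def by (metis abs_minus_commute compact_Icc)
  obtain dp where dp: "dp > 0" "\<And>x y. x \<in> {a..b} \<Longrightarrow> y \<in> {a..b} \<Longrightarrow> \<bar>x - y\<bar> < dp \<Longrightarrow> \<bar>\<Phi>p x - \<Phi>p y\<bar> < \<omega>"
    using modulus[OF \<Phi>p_cont] by blast
  obtain dm where dm: "dm > 0" "\<And>x y. x \<in> {a..b} \<Longrightarrow> y \<in> {a..b} \<Longrightarrow> \<bar>x - y\<bar> < dm \<Longrightarrow> \<bar>\<Phi>m x - \<Phi>m y\<bar> < \<omega>"
    using modulus[OF \<Phi>m_cont] by blast
  define \<rho>1 where "\<rho>1 = min \<rho> (min (dp / 2) (dm / 2))"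
  have \<rho>1: "0 < \<rho>1" "\<rho>1 \<le> \<rho>" "\<rho>1 < dp" "\<rho>1 < dm" using \<rho> dp dm by (auto simp: \<rho>1_def)
  have \<omega>_mod: "\<bar>\<Phi>p x - \<Phi>p y\<bar> \<le> \<omega> \<and> \<bar>\<Phi>m x - \<Phi>m y\<bar> \<le> \<omega>"
    if "x \<in> {a..b}" "y \<in> {a..b}" "\<bar>x - y\<bar> \<le> \<rho>1" for x y
    using dp(2)[OF that(1,2)] dm(2)[OF that(1,2)] that(3) \<rho>1 by (auto intro: less_imp_le)
  define \<epsilon> where "\<epsilon> = \<rho>1\<^sup>2 / (4 * M)"
  have \<epsilon>: "0 < \<epsilon>" "4 * M * \<epsilon> = \<rho>1\<^sup>2" using \<rho>1 M by (auto simp: \<epsilon>_def)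

  interpret doubling \<Phi>p \<Phi>m a b c0 B \<epsilon> \<delta> \<kappa> \<theta> \<eta> T g g'
  proof unfold_locales
    show "(g has_real_derivative g' t) (at t)" for t
      unfolding g_def g'_def by (auto intro!: derivative_eq_intros)
    show "continuous_on UNIV g'" unfolding g'_def by (intro continuous_intros)
    show "\<eta> \<le> g' t" if "0 \<le> t" for t
    proof -
      have "lam * (- T) \<le> lam * (t - T)" using that lam by (intro mult_left_mono) auto
      then show ?thesis unfolding \<eta>_def g'_def using M lam by (intro mult_left_mono) auto
    qed
  qed (use \<epsilon> \<delta> \<kappa> \<eta> \<mu> in \<open>auto simp: \<theta>_def\<close>)

  have g_nonneg: "0 \<le> g t" for t using M by (simp add: g_def)
  have g_T: "2 * M \<le> g T" by (simp add: g_def)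
  have gap: "B * E * (exp \<mu> - 1) + \<omega> * (E + 1) < \<eta>" using BE\<mu> \<omega> \<eta> by simp
  have \<kappa>\<theta>: "2 * \<kappa> * (b - a) + 2 * \<theta> \<le> \<mu>" using \<kappa>\<mu> by (simp add: \<theta>_def)
  have z_pen: "2 * \<kappa> * (z - mid)\<^sup>2 + 2 * g t \<le> \<sigma> / 2" if "z \<in> {a..b}" "t \<le> T0" for z t
  proof -
    have "2 * mid = a + b" by (simp add: mid_def)
    moreover have "a \<le> z" "z \<le> b" using that(1) by auto
    ultimately have "\<bar>z - mid\<bar> \<le> \<bar>b - a\<bar>" by linarith
    then have "\<kappa> * (z - mid)\<^sup>2 \<le> \<kappa> * (b - a)\<^sup>2"
      using \<kappa> by (intro mult_left_mono) (auto simp: abs_le_square_iff)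
    then show ?thesis using \<kappa>\<sigma> g_small[OF that(2)] by linarith
  qed

  \<comment> \<open>the two bounds on \<open>h\<close> that the discrete solutions require to satisfy the penalised inequalities\<close>
  define h0 where "h0 = min (2 * \<theta>) (\<kappa> * (b - a)) / (1 / \<epsilon> + 2 * \<kappa>)"
  have den: "0 < 1 / \<epsilon> + 2 * \<kappa>" using \<epsilon> \<kappa> by (simp add: add_pos_pos)
  have h0: "0 < h0" using den \<mu> \<kappa> ab by (simp add: h0_def \<theta>_def)
  show ?thesis
  proof (intro exI[of _ h0] conjI allI impI)
    fix r h W x t
    assume W: "discrete_solution \<Phi>p \<Phi>m w0 a b r h W" and h: "0 < h" "h < h0"
      and x: "x \<in> grid a b r h" and t: "0 \<le> t" "t \<le> T0"
    have xab: "x \<in> {a..b}" using x grid_subset by blast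
    have "h * (1 / \<epsilon> + 2 * \<kappa>) \<le> min (2 * \<theta>) (\<kappa> * (b - a))"
      using h den by (simp add: h0_def pos_less_divide_eq less_imp_le)
    then have h_theta: "h / (2 * \<epsilon>) + \<kappa> * h \<le> \<theta>" and h_bdry: "h / \<epsilon> + 2 * \<kappa> * h \<le> \<kappa> * (b - a)"
      using \<epsilon> by (auto simp: distrib_left algebra_simps)
    let ?W = "\<lambda>(x, t). W x t"
    have grid: "compact (grid a b r h)" "grid a b r h \<subseteq> {a..b}"
      using finite_grid[OF h(1)] grid_subset by (auto intro: finite_imp_compact)
    have W_layer': "\<bar>?W (x, t) - w0 y\<bar> \<le> \<sigma> / 4"
      if "x \<in> grid a b r h" "y \<in> {a..b}" "\<bar>x - y\<bar> \<le> \<rho>" "0 \<le> t" "t \<le> \<rho>" for x y t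
      using W_layer[OF W h(1) that(1,2)] that \<rho>(2) by auto
    have W_bound': "\<bar>?W (x, t)\<bar> \<le> M" if "x \<in> grid a b r h" "t \<in> {0..T}" for x t
      using W_bound[OF W h(1) that] by simp
    have tT: "t \<le> T" using t by (simp add: T_def)
    note W_cont = discrete_solution_continuous[OF W h(1), of T]
    have "?W (x, t) - w (x, t) \<le> \<sigma>"
      by (rule penalised_comparison[OF grid compact_Icc order_refl W_cont w_cont W_bound' w_bound
            discrete_imp_penalised_sub[OF W h(1) h_theta h_bdry] viscosity_imp_penalised_super[OF super]
            g_nonneg g_T W_layer' w_layer \<omega>_mod _ _ _ _ _ \<kappa>\<theta> gap \<sigma> x xab t(1) tT z_pen[OF xab t(2)]])
        (use \<rho>1 \<delta> \<epsilon> in \<open>auto simp: E_def\<close>)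
    moreover have "w (x, t) - ?W (x, t) \<le> \<sigma>"
      by (rule penalised_comparison[OF compact_Icc order_refl grid w_cont W_cont w_bound W_bound'
            viscosity_imp_penalised_sub[OF sub] discrete_imp_penalised_super[OF W h(1) h_theta h_bdry]
            g_nonneg g_T w_layer W_layer' \<omega>_mod _ _ _ _ _ \<kappa>\<theta> gap \<sigma> xab x t(1) tT z_pen[OF xab t(2)]])
        (use \<rho>1 \<delta> \<epsilon> in \<open>auto simp: E_def\<close>)
    ultimately show "\<bar>W x t - w (x, t)\<bar> \<le> \<sigma>" by (simp add: abs_le_iff)
  qed fact
qed

end

section \<open>The relaxed limits\<close>

lemma grid_point_near:
  assumes "\<alpha> \<in> {a..b}" "0 < h" "h < b - a"
  shows "\<exists>x\<in>grid a b 0 h. \<bar>x - \<alpha>\<bar> \<le> h"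
proof -
  define k where "k = \<lfloor>\<alpha> / h\<rfloor>"
  have "k \<le> \<alpha> / h" "\<alpha> / h < k + 1" unfolding k_def by linarith+
  then have k: "k * h \<le> \<alpha>" "\<alpha> < (k + 1) * h"
    using assms(2) by (simp_all add: pos_le_divide_eq pos_divide_less_eq)
  show ?thesis
  proof (cases "a \<le> k * h")
    case True
    then have "k * h \<in> grid a b 0 h" using k assms by (auto simp: grid_def)
    then show ?thesis using k by (intro bexI[of _ "k * h"]) (auto simp: abs_le_iff algebra_simps)
  next
    case False
    then have "(k + 1) * h \<in> grid a b 0 h"
      using k assms by (auto simp: grid_def algebra_simps intro!: exI[of _ "k + 1"])
    then show ?thesis using k by (intro bexI[of _ "(k + 1) * h"]) (auto simp: abs_le_iff algebra_simps)
  qed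
qed

text \<open>
  The filter is nontrivial along the curve \<open>r = 0\<close>, \<open>s = t\<close> with \<open>x\<close> the grid point next to \<open>\<alpha>\<close>.
  Without this the limit superior would be \<open>-\<infinity>\<close> and the limit inferior \<open>\<infinity>\<close>.
\<close>

lemma relaxed_filter_neq_bot:
  assumes "a < b" "\<alpha> \<in> {a..b}" "0 \<le> t"
  shows "relaxed_filter a b \<alpha> t \<noteq> bot"
proof
  define near where "near = (\<lambda>h. SOME x. x \<in> grid a b 0 h \<and> \<bar>x - \<alpha>\<bar> \<le> h)"
  have near: "near h \<in> grid a b 0 h \<and> \<bar>near h - \<alpha>\<bar> \<le> h" if "0 < h" "h < b - a" for h
    unfolding near_def by (rule someI_ex) (use grid_point_near[OF assms(2) that] in blast)
  have small: "\<forall>\<^sub>F h in at_right 0. 0 < h \<and> h < b - a"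
    using assms(1) by (auto simp: eventually_at_right_field intro: exI[of _ "b - a"])
  have "\<forall>\<^sub>F h in at_right 0. norm (near h - \<alpha>) \<le> h"
    using small by (rule eventually_mono) (use near in auto)
  then have "((\<lambda>h. near h - \<alpha>) \<longlongrightarrow> 0) (at_right 0)"
    by (rule Lim_null_comparison) (rule tendsto_ident_at)
  then have near_lim: "(near \<longlongrightarrow> \<alpha>) (at_right 0)" by (rule LIM_zero_cancel)
  have "filterlim (\<lambda>h. (h, 0, near h, t)) (relaxed_filter a b \<alpha> t) (at_right 0)"
    unfolding relaxed_filter_def filterlim_inf filterlim_principal
  proof
    show "filterlim (\<lambda>h. (h, 0, near h, t)) (at_right 0 \<times>\<^sub>F nhds 0 \<times>\<^sub>F nhds \<alpha> \<times>\<^sub>F nhds t) (at_right 0)"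
      by (intro filterlim_Pair filterlim_ident near_lim tendsto_const)
    show "\<forall>\<^sub>F h in at_right 0. (h, 0, near h, t) \<in> {(h, r, x, s). x \<in> grid a b r h \<and> 0 \<le> s}"
      using small by (rule eventually_mono) (use near assms(3) in auto)
  qed
  moreover assume "relaxed_filter a b \<alpha> t = bot"
  ultimately have "filtermap (\<lambda>h. (h, 0::real, near h, t)) (at_right 0) = bot"
    by (simp add: filterlim_def le_bot)
  then show False using trivial_limit_at_right_real[of "0::real"]
    by (simp add: filtermap_bot_iff)
qed

theorem corollary3p5:
  fixes \<Omega> :: "(real^2) set"
    and \<nu>p \<nu>m :: nat
    and \<Phi>p \<Phi>m u0 :: "real^2 \<Rightarrow> real"
    and c0 a b \<delta> :: real
    and x0 \<nu> :: "real^2"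
    and W :: "real \<Rightarrow> real \<Rightarrow> real \<Rightarrow> real \<Rightarrow> real"
    and w :: "real \<times> real \<Rightarrow> real"
  assumes "bounded \<Omega>" and "open \<Omega>" and "connected \<Omega>"
    and "lipschitz_boundary \<Omega>"
    and "closure \<Omega> \<subseteq> positive_quadrant"
    and "\<nu>p \<noteq> 0 \<or> \<nu>m \<noteq> 0"
    and "\<nu> = reaction_vector \<nu>p \<nu>m"
    and "continuous_on (closure \<Omega>) \<Phi>p" and "continuous_on (closure \<Omega>) \<Phi>m"
    and "c0 > 0"
    and "\<And>x. x \<in> closure \<Omega> \<Longrightarrow> \<Phi>p x \<ge> c0"
    and "\<And>x. x \<in> closure \<Omega> \<Longrightarrow> \<Phi>m x \<ge> c0"
    and "x0 \<in> closure \<Omega>"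
    and "largest_interval (closure \<Omega>) x0 \<nu> a b"
    and "a < b"
    and "continuous_on (closure \<Omega>) u0"
    and "\<delta> > 0"
    and "\<And>r h. 0 < h \<Longrightarrow> h < \<delta> \<Longrightarrow> \<bar>r\<bar> < \<delta> \<Longrightarrow>
           discrete_solution (along x0 \<nu> \<Phi>p) (along x0 \<nu> \<Phi>m) (along x0 \<nu> u0) a b r h (W r h)"
    and "viscosity_solution (hamiltonian (along x0 \<nu> \<Phi>p) (along x0 \<nu> \<Phi>m)) (along x0 \<nu> u0) a b w"
  shows "\<forall>\<alpha>\<in>{a..b}. \<forall>t\<ge>0.
           relaxed_limsup a b W \<alpha> t = ereal (w (\<alpha>, t)) \<and>
           relaxed_liminf a b W \<alpha> t = ereal (w (\<alpha>, t))"
proof (intro ballI allI impI)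
  fix \<alpha> t :: real assume \<alpha>: "\<alpha> \<in> {a..b}" and t: "0 \<le> t"
  let ?\<Phi>p = "along x0 \<nu> \<Phi>p" and ?\<Phi>m = "along x0 \<nu> \<Phi>m" and ?w0 = "along x0 \<nu> u0"
  have in_closure: "x0 + x *\<^sub>R \<nu> \<in> closure \<Omega>" if "x \<in> {a..b}" for x
    using assms(14) that by (auto simp: largest_interval_def)
  have along_cont: "continuous_on {a..b} (along x0 \<nu> f)" if "continuous_on (closure \<Omega>) f" for f
    unfolding along_def
    by (rule continuous_on_compose2[OF that]) (auto intro!: continuous_intros in_closure)
  have along_bounded: "\<exists>N. \<forall>x\<in>{a..b}. along x0 \<nu> f x \<le> N" if "continuous_on (closure \<Omega>) f" for f
    using continuous_attains_sup[OF compact_Icc _ along_cont[OF that]] assms(15) by fastforce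
  obtain N1 N2 where N: "\<forall>x\<in>{a..b}. ?\<Phi>p x \<le> N1" "\<forall>x\<in>{a..b}. ?\<Phi>m x \<le> N2"
    using along_bounded assms(8,9) by metis
  interpret intensities ?\<Phi>p ?\<Phi>m a b c0 "max N1 N2"
  proof unfold_locales
    show "c0 \<le> ?\<Phi>p x \<and> ?\<Phi>p x \<le> max N1 N2" "c0 \<le> ?\<Phi>m x \<and> ?\<Phi>m x \<le> max N1 N2"
      if "x \<in> {a..b}" for x
      using N that assms(11,12)[OF in_closure[OF that]] by (auto simp: along_def le_max_iff_disj)
  qed fact+
  let ?F = "relaxed_filter a b \<alpha> t"
  have "((\<lambda>(h, r, x, s). W r h x s) \<longlongrightarrow> w (\<alpha>, t)) ?F"
  proof (rule tendstoI)
    fix \<sigma> :: real assume \<sigma>: "0 < \<sigma>"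
    obtain h0 where h0: "0 < h0" and close: "\<And>r h V x s. discrete_solution ?\<Phi>p ?\<Phi>m ?w0 a b r h V \<Longrightarrow>
        0 < h \<Longrightarrow> h < h0 \<Longrightarrow> x \<in> grid a b r h \<Longrightarrow> 0 \<le> s \<Longrightarrow> s \<le> t + 1 \<Longrightarrow> \<bar>V x s - w (x, s)\<bar> \<le> \<sigma> / 2"
      using discrete_uniformly_close[OF along_cont[OF assms(8)] along_cont[OF assms(9)]
          along_cont[OF assms(16)] assms(19), of "\<sigma> / 2" "t + 1"] \<sigma> t by auto
    have "continuous_on ({a..b} \<times> {0..}) w" using assms(19) by (simp add: viscosity_solution_def)
    then have "\<exists>d>0. \<forall>p\<in>{a..b} \<times> {0..}. dist p (\<alpha>, t) < d \<longrightarrow> dist (w p) (w (\<alpha>, t)) < \<sigma> / 2"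
      using \<alpha> t \<sigma> unfolding continuous_on_iff
      by (elim ballE[of _ _ "(\<alpha>, t)"] allE[of _ "\<sigma> / 2"]) auto
    then obtain d where d: "0 < d" and dw: "\<And>x s. x \<in> {a..b} \<Longrightarrow> 0 \<le> s \<Longrightarrow>
        dist (x, s) (\<alpha>, t) < d \<Longrightarrow> \<bar>w (x, s) - w (\<alpha>, t)\<bar> < \<sigma> / 2"
      unfolding dist_real_def by auto
    have "\<forall>\<^sub>F h in at_right 0. 0 < h \<and> h < min h0 \<delta>"
      using h0 assms(17) by (auto simp: eventually_at_right_field intro: exI[of _ "min h0 \<delta>"])
    moreover have "\<forall>\<^sub>F r in nhds (0::real). \<bar>r\<bar> < \<delta>"
      using assms(17) by (auto simp: eventually_nhds_metric dist_real_def)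
    moreover have "\<forall>\<^sub>F x in nhds \<alpha>. \<bar>x - \<alpha>\<bar> < d / 2"
      using d by (auto simp: eventually_nhds_metric dist_real_def intro!: exI[of _ "d / 2"])
    moreover have "\<forall>\<^sub>F s in nhds t. \<bar>s - t\<bar> < min (d / 2) 1"
      using d by (auto simp: eventually_nhds_metric dist_real_def intro!: exI[of _ "min (d / 2) 1"])
    ultimately have "\<forall>\<^sub>F (h, r, x, s) in at_right 0 \<times>\<^sub>F nhds 0 \<times>\<^sub>F nhds \<alpha> \<times>\<^sub>F nhds t.
        (0 < h \<and> h < min h0 \<delta>) \<and> \<bar>r\<bar> < \<delta> \<and> \<bar>x - \<alpha>\<bar> < d / 2 \<and> \<bar>s - t\<bar> < min (d / 2) 1"
      unfolding case_prod_unfold by (intro eventually_prodI)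
    then have "\<forall>\<^sub>F p in ?F. (case p of (h, r, x, s) \<Rightarrow>
        ((0 < h \<and> h < min h0 \<delta>) \<and> \<bar>r\<bar> < \<delta> \<and> \<bar>x - \<alpha>\<bar> < d / 2 \<and> \<bar>s - t\<bar> < min (d / 2) 1) \<and>
        x \<in> grid a b r h \<and> 0 \<le> s)"
      unfolding relaxed_filter_def eventually_inf_principal
      by (rule eventually_mono) auto
    then show "\<forall>\<^sub>F p in ?F. dist (case p of (h, r, x, s) \<Rightarrow> W r h x s) (w (\<alpha>, t)) < \<sigma>"
    proof (rule eventually_mono, clarify)
      fix h r x s
      assume h: "0 < h" "h < min h0 \<delta>" and r: "\<bar>r\<bar> < \<delta>" and x: "\<bar>x - \<alpha>\<bar> < d / 2" "x \<in> grid a b r h"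
        and s: "\<bar>s - t\<bar> < min (d / 2) 1" "0 \<le> s"
      have xab: "x \<in> {a..b}" using x grid_subset by blast
      have "\<bar>W r h x s - w (x, s)\<bar> \<le> \<sigma> / 2"
        using h r x s by (intro close[OF assms(18)]) auto
      moreover have "dist (x, s) (\<alpha>, t) < d"
        using norm_Pair_le[of "x - \<alpha>" "s - t"] x s by (simp add: dist_norm)
      then have "\<bar>w (x, s) - w (\<alpha>, t)\<bar> < \<sigma> / 2" by (rule dw[OF xab s(2)])
      ultimately show "dist (W r h x s) (w (\<alpha>, t)) < \<sigma>" unfolding dist_real_def by linarith
    qed
  qed
  then have "((\<lambda>p. ereal (case p of (h, r, x, s) \<Rightarrow> W r h x s)) \<longlongrightarrow> ereal (w (\<alpha>, t))) ?F"
    by (rule tendsto_ereal)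
  then have "((\<lambda>(h, r, x, s). ereal (W r h x s)) \<longlongrightarrow> ereal (w (\<alpha>, t))) ?F"
    by (simp add: case_prod_unfold)
  then show "relaxed_limsup a b W \<alpha> t = ereal (w (\<alpha>, t)) \<and> relaxed_liminf a b W \<alpha> t = ereal (w (\<alpha>, t))"
    unfolding relaxed_limsup_def relaxed_liminf_def
    using relaxed_filter_neq_bot[OF assms(15) \<alpha> t] lim_imp_Limsup lim_imp_Liminf by blast
qed

end
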